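(* Let $\mathcal{C}$ be a wreath-closed permutation class containing only finitely many simple permutations, let $\mathcal{P}$ be a finite query-complete set of properties, and let $\mathcal{Q}\subseteq\mathcal{P}$. Then the generating function $f_{\mathcal{Q}}=\sum_{n}|\{\pi\in\mathcal{C}\cap S_n : \pi\in Q \text{ for all } Q\in\mathcal{Q}\}|\,x^n$ is algebraic over $\mathbb{Q}(x)$.
   Context: A permutation $\pi$ contains $\sigma$ if $\pi$ has a subsequence order-isomorphic to $\sigma$; a permutation class is a set of permutations closed downward under containment. An interval of $\pi\in S_n$ is a set of contiguous indices $[a,b]$ whose image under $\pi$ is a set of consecutive integers; $\pi$ is simple if its only intervals have size $0$, $1$, or $n$. For $\sigma\in S_m$ and nonempty permutations $\alpha_1,\dots,\alpha_m$, the inflation $\sigma[\alpha_1,\dots,\alpha_m]$ is the permutation obtained by replacing each entry $\sigma(i)$ by an interval order-isomorphic to $\alpha_i$ (e.g. $2413[1,132,321,12]=479832156$). A class $\mathcal{C}$ is wreath-closed if $\sigma[\alpha_1,\dots,\alpha_m]\in\mathcal{C}$ whenever $\sigma,\alpha_1,\dots,\alpha_m\in\mathcal{C}$ (equivalently, $\mathcal{C}$ is the largest class whose simple permutations are those of $\mathcal{C}$). A property is any set of permutations; $\pi$ satisfies $P$ if $\pi\in P$. A set $\mathcal{P}$ of properties is query-complete if for every permutation $\sigma\in S_m$ and every $P\in\mathcal{P}$, whether $\sigma[\alpha_1,\dots,\alpha_m]$ satisfies $P$ is determined by $\sigma$ together with the knowledge, for each $i\in[m]$ and each $Q\in\mathcal{P}$,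 of whether $\alpha_i$ satisfies $Q$ (i.e. if $\alpha_i$ and $\beta_i$ satisfy exactly the same properties of $\mathcal{P}$ for every $i$, then $\sigma[\alpha_1,\dots,\alpha_m]\in P\iff\sigma[\beta_1,\dots,\beta_m]\in P$). *)

theory Defs
  imports "HOL-Computational_Algebra.Computational_Algebra"
begin

text \<open>Permutations of length n are represented as lists that are arrangements
of 0,...,n-1 (one-line notation, shifted to start at 0).\<close>

definition is_perm :: "nat list \<Rightarrow> bool" where
  "is_perm xs \<longleftrightarrow> distinct xs \<and> set xs = {0..<length xs}"

definition order_iso :: "nat list \<Rightarrow> nat list \<Rightarrow> bool" where
  "order_iso xs ys \<longleftrightarrow> length xs = length ys \<and>
     (\<forall>i<length xs. \<forall>j<length xs. xs ! i < xs ! j \<longleftrightarrow> ys ! i < ys ! j)"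

definition perm_contains :: "nat list \<Rightarrow> nat list \<Rightarrow> bool" where
  "perm_contains \<pi> \<sigma> \<longleftrightarrow> (\<exists>I. I \<subseteq> {0..<length \<pi>} \<and> order_iso (nths \<pi> I) \<sigma>)"

definition perm_class :: "nat list set \<Rightarrow> bool" where
  "perm_class C \<longleftrightarrow> (\<forall>\<pi>\<in>C. is_perm \<pi>) \<and>
     (\<forall>\<pi>\<in>C. \<forall>\<sigma>. is_perm \<sigma> \<and> perm_contains \<pi> \<sigma> \<longrightarrow> \<sigma> \<in> C)"

definition is_interval :: "nat list \<Rightarrow> nat \<Rightarrow> nat \<Rightarrow> bool" where
  "is_interval \<pi> a b \<longleftrightarrow> a \<le> b \<and> b < length \<pi> \<and>
     (\<exists>c. (\<lambda>i. \<pi> ! i) ` {a..b} = {c..c + (b - a)})"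

definition simple_perm :: "nat list \<Rightarrow> bool" where
  "simple_perm \<pi> \<longleftrightarrow> is_perm \<pi> \<and>
     (\<forall>a b. is_interval \<pi> a b \<longrightarrow> b = a \<or> (a = 0 \<and> b = length \<pi> - 1))"

definition inflate :: "nat list \<Rightarrow> nat list list \<Rightarrow> nat list" where
  "inflate \<sigma> \<alpha>s = concat (map (\<lambda>i. map (\<lambda>x. x + (\<Sum>j\<in>{j. j < length \<sigma> \<and> \<sigma> ! j < \<sigma> ! i}. length (\<alpha>s ! j)))
        (\<alpha>s ! i)) [0..<length \<sigma>])"

definition valid_blocks :: "nat list \<Rightarrow> nat list list \<Rightarrow> bool" where
  "valid_blocks \<sigma> \<alpha>s \<longleftrightarrow> length \<alpha>s = length \<sigma> \<and> (\<forall>\<alpha>\<in>set \<alpha>s. is_perm \<alpha> \<and> \<alpha> \<noteq> [])"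

definition wreath_closed :: "nat list set \<Rightarrow> bool" where
  "wreath_closed C \<longleftrightarrow> (\<forall>\<sigma> \<alpha>s. \<sigma> \<in> C \<and> valid_blocks \<sigma> \<alpha>s \<and> set \<alpha>s \<subseteq> C \<longrightarrow> inflate \<sigma> \<alpha>s \<in> C)"

text \<open>A property is any set of permutations (type nat list set).\<close>
definition query_complete :: "nat list set set \<Rightarrow> bool" where
  "query_complete \<P> \<longleftrightarrow> (\<forall>\<sigma> \<alpha>s \<beta>s. is_perm \<sigma> \<and> valid_blocks \<sigma> \<alpha>s \<and> valid_blocks \<sigma> \<beta>s \<and>
      (\<forall>i<length \<sigma>. \<forall>Q\<in>\<P>. \<alpha>s ! i \<in> Q \<longleftrightarrow> \<beta>s ! i \<in> Q) \<longrightarrow>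
      (\<forall>P\<in>\<P>. inflate \<sigma> \<alpha>s \<in> P \<longleftrightarrow> inflate \<sigma> \<beta>s \<in> P))"

text \<open>Algebraic over Q(x): annihilated by a nonzero polynomial in y with coefficients
in Q[x] (denominators cleared).\<close>
definition fps_algebraic :: "rat fps \<Rightarrow> bool" where
  "fps_algebraic f \<longleftrightarrow> (\<exists>ps :: rat poly list. (\<exists>p\<in>set ps. p \<noteq> 0) \<and>
      (\<Sum>i<length ps. fps_of_poly (ps ! i) * f ^ i) = 0)"

definition gen_fun :: "nat list set \<Rightarrow> nat list set set \<Rightarrow> rat fps" where
  "gen_fun C \<Q> = Abs_fps (\<lambda>n. of_nat (card {\<pi>\<in>C. length \<pi> = n \<and> (\<forall>Q\<in>\<Q>. \<pi> \<in> Q)}))"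

end

theory Submission
  imports Defs "HOL-Library.Sublist"
begin

text \<open>Every permutation of length at least two is the inflation of a unique simple permutation, and
  the blocks are unique as well once the first block of an inflation of 01 or 10 is required to be
  indecomposable. Sorting the permutations of the class by the properties they satisfy and by their
  decomposability, query-completeness turns this decomposition into a finite system of equations
  \<open>y i = b i * x + (sum of products of at least two of the y j)\<close> for the generating functions.

  Algebraicity of the solution avoids elimination theory: perturb the equations to
  \<open>y i = b i * x + ... + s * y i ^ N\<close> with a new parameter \<open>s\<close> and large \<open>N\<close>. Since \<open>s * y i ^ N\<close> is a
  combination of monomials of lower degree, the algebra generated by the solution is finite-dimensional
  over the rational functions in \<open>s\<close> and \<open>x\<close>, so each of its elements satisfies a polynomial relation, which
  specialises at \<open>s = 0\<close>.\<close>

section \<open>Polynomial systems of power series\<close>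

text \<open>Without the parameter, replacing \<open>y i\<close> by its right-hand side lengthens
  words, and nothing bounds the degree of the monomials needed; the extra power turns each equation
  into a rule that shortens words. The price is a division by \<open>s\<close>:
  \<open>spanned\<close> keeps the powers of \<open>s\<close> explicit, and a relation found this
  way may vanish identically at \<open>s = 0\<close> until a common power of \<open>s\<close> is
  cancelled. The way back to the counting series uses only uniqueness: words have length at least
  two and the series have constant term 0, so the right-hand sides contract x-adically and the
  perturbed solution specialises at \<open>s = 0\<close> to the given one.

  On the combinatorial side, the condition on the first block of an inflation of 01 or 10 need not
  be expressible by the given properties. The class \<open>cl\<close> therefore also records sum and
  skew decomposability. The classes stay finite in number and compatible with inflation, because
  decomposability of an inflation along a simple permutation of length at least two depends on that
  permutation alone. The empty permutation is counted apart: it cannot be a block and would spoil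
  the constant terms.\<close>

lemma nontrivial_linear_relation:
  fixes v :: "'k \<Rightarrow> 'b \<Rightarrow> 'a::idom"
  assumes "finite W" "finite K" "card W < card K"
  shows "\<exists>c. (\<exists>k\<in>K. c k \<noteq> 0) \<and> (\<forall>w\<in>W. (\<Sum>k\<in>K. c k * v k w) = 0)"
  using assms
proof (induction W arbitrary: K v rule: finite_induct)
  case empty
  then have "K \<noteq> {}" by auto
  then show ?case by (intro exI[of _ "\<lambda>_. 1"]) auto
next
  case (insert w0 W)
  show ?case
  proof (cases "\<forall>k\<in>K. v k w0 = 0")
    case True
    have "card W < card K" using insert by auto
    from insert.IH[OF insert.prems(1) this, of v] True show ?thesis by auto
  next
    case False
    then obtain k0 where k0: "k0 \<in> K" "v k0 w0 \<noteq> 0" by auto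
    define p where "p = v k0 w0"
    define K' where "K' = K - {k0}"
    have K': "finite K'" "card W < card K'" "k0 \<notin> K'" "K = insert k0 K'"
      using insert k0 by (auto simp: K'_def card_Diff_singleton)
    obtain c where c: "\<exists>k\<in>K'. c k \<noteq> 0"
      "\<forall>w\<in>W. (\<Sum>k\<in>K'. c k * (p * v k w - v k w0 * v k0 w)) = 0"
      using insert.IH[OF K'(1,2), of "\<lambda>k w. p * v k w - v k w0 * v k0 w"] by blast
    \<comment> \<open>Fraction-free elimination with pivot \<open>p\<close>: the equation at
      \<open>w0\<close> is solved for the unknown \<open>k0\<close>, and the other unknowns are
      multiplied by \<open>p\<close> instead of dividing by it. Absence of zero divisors keeps the
      solution nontrivial.\<close>
    define d where "d = (\<lambda>k. if k = k0 then - (\<Sum>k\<in>K'. c k * v k w0) else c k * p)"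
    have d: "(\<Sum>k\<in>K. d k * v k w) = (\<Sum>k\<in>K'. c k * (p * v k w - v k w0 * v k0 w))" for w
    proof -
      have "(\<Sum>k\<in>K. d k * v k w) = d k0 * v k0 w + (\<Sum>k\<in>K'. d k * v k w)"
        using K' by simp
      also have "(\<Sum>k\<in>K'. d k * v k w) = (\<Sum>k\<in>K'. c k * p * v k w)"
        using K' by (intro sum.cong) (auto simp: d_def)
      finally show ?thesis
        by (simp add: d_def[THEN fun_cong, of k0] sum_distrib_right sum_distrib_left algebra_simps sum_subtractf)
    qed
    have "\<exists>k\<in>K. d k \<noteq> 0" using c(1) K' k0 by (auto simp: d_def p_def)
    moreover have "\<forall>w\<in>insert w0 W. (\<Sum>k\<in>K. d k * v k w) = 0"
      using c(2) by (auto simp: d) (simp add: p_def algebra_simps)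
    ultimately show ?thesis by blast
  qed
qed

section \<open>x-adic contraction and solvability of word systems\<close>

lemma fps_X_power_dvd_iff:
  fixes f :: "'a::comm_ring_1 fps"
  shows "fps_X ^ n dvd f \<longleftrightarrow> (\<forall>m<n. f $ m = 0)"
proof
  assume "fps_X ^ n dvd f"
  then show "\<forall>m<n. f $ m = 0" by (auto simp: dvd_def fps_X_power_mult_nth)
next
  assume "\<forall>m<n. f $ m = 0"
  then have "f = fps_X ^ n * fps_shift n f"
    by (intro fps_ext) (auto simp: fps_X_power_mult_nth)
  then show "fps_X ^ n dvd f" by (rule dvdI)
qed

lemma fps_X_dvd_iff: "fps_X dvd (f :: 'a::comm_ring_1 fps) \<longleftrightarrow> f $ 0 = 0"
  using fps_X_power_dvd_iff[of 1 f] by simp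

lemma fps_eq_if_fps_X_power_dvd:
  fixes f g :: "'a::comm_ring_1 fps"
  assumes "\<And>n. fps_X ^ n dvd f - g"
  shows "f = g"
proof (rule fps_ext)
  fix n show "f $ n = g $ n"
    using assms[of "Suc n"] unfolding fps_X_power_dvd_iff by auto
qed

lemma prod_list_diff_dvd:
  fixes y z :: "'i \<Rightarrow> 'a::comm_ring_1"
  assumes "\<And>i. i \<in> set w \<Longrightarrow> d dvd y i - z i"
  shows "d dvd prod_list (map y w) - prod_list (map z w)"
  using assms
proof (induction w)
  case (Cons a w)
  have "prod_list (map y (a # w)) - prod_list (map z (a # w)) =
    (y a - z a) * prod_list (map y w) + z a * (prod_list (map y w) - prod_list (map z w))"
    by (simp add: algebra_simps)
  with Cons show ?case by simp
qed simp

text \<open>Changing one factor always leaves another one, which contributes a further factor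
  \<open>x\<close>. This gain makes the system a contraction and is the reason for asking words to
  have length at least two.\<close>

lemma prod_list_diff_dvd_Suc:
  fixes y z :: "'i \<Rightarrow> 'a::comm_ring_1"
  assumes "\<And>i. i \<in> set w \<Longrightarrow> x ^ n dvd y i - z i"
    and "\<And>i. i \<in> set w \<Longrightarrow> x dvd y i" and "\<And>i. i \<in> set w \<Longrightarrow> x dvd z i"
    and "length w \<ge> 2"
  shows "x ^ Suc n dvd prod_list (map y w) - prod_list (map z w)"
proof -
  obtain a b u where w: "w = a # b # u"
    using assms(4) by (cases w; cases "tl w") auto
  let ?p = "\<lambda>y. prod_list (map y (b # u))"
  have "x dvd ?p y" using assms(2)[of b] w by simp
  then have 1: "x ^ n * x dvd (y a - z a) * ?p y"
    using assms(1)[of a] w by (intro mult_dvd_mono) auto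
  have "x ^ n dvd ?p y - ?p z"
    using assms(1) w by (intro prod_list_diff_dvd) auto
  then have 2: "x * x ^ n dvd z a * (?p y - ?p z)"
    using assms(3)[of a] w by (intro mult_dvd_mono) auto
  have "prod_list (map y w) - prod_list (map z w) = (y a - z a) * ?p y + z a * (?p y - ?p z)"
    by (simp add: w algebra_simps)
  with 1 2 show ?thesis by (simp add: mult.commute)
qed

text \<open>Terms are indexed by an abstract type with a word attached, not by the words themselves,
  so that different simple permutations can contribute the same word with multiplicity.\<close>

locale word_system =
  fixes I :: "'i set" and T :: "'i \<Rightarrow> 't set" and wd :: "'t \<Rightarrow> 'i list" and b :: "'i \<Rightarrow> bool"
  assumes finite_I: "finite I"
    and finite_T: "\<And>i. i \<in> I \<Longrightarrow> finite (T i)"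
    and wd_I: "\<And>i t. i \<in> I \<Longrightarrow> t \<in> T i \<Longrightarrow> set (wd t) \<subseteq> I"
    and wd_length: "\<And>i t. i \<in> I \<Longrightarrow> t \<in> T i \<Longrightarrow> length (wd t) \<ge> 2"
begin

text \<open>Coefficient ring and \<open>c\<close> stay open: \<open>c = 0\<close> over the rationals
  is the counting system, \<open>c = [:0, 1:]\<close> over \<open>rat poly\<close> the perturbed
  one, and one contraction argument covers both.\<close>

definition rhs :: "'a::comm_ring_1 \<Rightarrow> nat \<Rightarrow> ('i \<Rightarrow> 'a fps) \<Rightarrow> 'i \<Rightarrow> 'a fps" where
  "rhs c N y i = of_bool (b i) * fps_X + (\<Sum>t\<in>T i. prod_list (map y (wd t))) + fps_const c * y i ^ N"

lemma rhs_contract: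
  fixes y z :: "'i \<Rightarrow> 'a::comm_ring_1 fps"
  assumes "\<And>i. i \<in> I \<Longrightarrow> fps_X dvd y i" and "\<And>i. i \<in> I \<Longrightarrow> fps_X dvd z i"
    and "\<And>i. i \<in> I \<Longrightarrow> fps_X ^ n dvd y i - z i" and "i \<in> I" "N \<ge> 2"
  shows "fps_X ^ Suc n dvd rhs c N y i - rhs c N z i"
proof -
  have "fps_X ^ Suc n dvd (\<Sum>t\<in>T i. prod_list (map y (wd t)) - prod_list (map z (wd t)))"
    using assms wd_I[OF \<open>i \<in> I\<close>, THEN subsetD] wd_length[OF \<open>i \<in> I\<close>]
    by (intro dvd_sum prod_list_diff_dvd_Suc) (auto simp del: power_Suc)
  moreover have "fps_X ^ Suc n dvd prod_list (map y (replicate N i)) - prod_list (map z (replicate N i))"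
    using assms by (intro prod_list_diff_dvd_Suc) auto
  then have "fps_X ^ Suc n dvd fps_const c * (y i ^ N - z i ^ N)"
    by (simp add: prod_list_replicate del: power_Suc)
  ultimately have "fps_X ^ Suc n dvd
    (\<Sum>t\<in>T i. prod_list (map y (wd t)) - prod_list (map z (wd t))) + fps_const c * (y i ^ N - z i ^ N)"
    by (rule dvd_add)
  also have "\<dots> = rhs c N y i - rhs c N z i"
    by (simp add: rhs_def sum_subtractf algebra_simps)
  finally show ?thesis .
qed

lemma rhs_const_0:
  fixes y :: "'i \<Rightarrow> 'a::comm_ring_1 fps"
  assumes "\<And>i. i \<in> I \<Longrightarrow> fps_X dvd y i" and "i \<in> I" "N \<ge> 2"
  shows "fps_X dvd rhs c N y i"
proof -
  have "fps_X dvd prod_list (map y (wd t))" if "t \<in> T i" for t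
    using wd_I[OF \<open>i \<in> I\<close> that] wd_length[OF \<open>i \<in> I\<close> that] assms(1)
    by (cases "wd t") auto
  moreover have "fps_X dvd y i ^ N"
    using assms by (cases N) auto
  ultimately show ?thesis unfolding rhs_def by (intro dvd_add dvd_sum dvd_mult) auto
qed

lemma solution_unique:
  fixes y z :: "'i \<Rightarrow> 'a::comm_ring_1 fps"
  assumes y: "\<And>i. i \<in> I \<Longrightarrow> fps_X dvd y i" "\<And>i. i \<in> I \<Longrightarrow> y i = rhs c N y i"
    and z: "\<And>i. i \<in> I \<Longrightarrow> fps_X dvd z i" "\<And>i. i \<in> I \<Longrightarrow> z i = rhs c N z i"
    and "i \<in> I" "N \<ge> 2"
  shows "y i = z i"
proof (rule fps_eq_if_fps_X_power_dvd)
  fix n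
  have "\<forall>i\<in>I. fps_X ^ n dvd y i - z i"
  proof (induction n)
    case (Suc n)
    show ?case
    proof
      fix i assume "i \<in> I"
      then have "fps_X ^ Suc n dvd rhs c N y i - rhs c N z i"
        using Suc y(1) z(1) \<open>N \<ge> 2\<close> by (intro rhs_contract) auto
      with \<open>i \<in> I\<close> y(2) z(2) show "fps_X ^ Suc n dvd y i - z i" by metis
    qed
  qed simp
  with \<open>i \<in> I\<close> show "fps_X ^ n dvd y i - z i" by blast
qed

lemma solution_exists:
  fixes c :: "'a::comm_ring_1"
  assumes "N \<ge> 2"
  obtains y where "\<And>i. i \<in> I \<Longrightarrow> fps_X dvd y i" "\<And>i. i \<in> I \<Longrightarrow> y i = rhs c N y i"
proof -
  define Y where "Y = (\<lambda>k. (rhs c N ^^ k) (\<lambda>_. 0))"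
  have Y_Suc: "Y (Suc k) = rhs c N (Y k)" for k by (simp add: Y_def)
  have Y_dvd: "fps_X dvd Y k i" if "i \<in> I" for k i
    using that
  proof (induction k arbitrary: i)
    case 0 then show ?case by (simp add: Y_def)
  next
    case (Suc k) then show ?case using rhs_const_0[of "Y k"] assms by (simp add: Y_Suc)
  qed
  have step: "fps_X ^ n dvd Y (n + k) i - Y n i" if "i \<in> I" for n k i
    using that
  proof (induction n arbitrary: i)
    case (Suc n)
    then show ?case
      unfolding add_Suc Y_Suc using Y_dvd assms by (intro rhs_contract) auto
  qed simp
  \<comment> \<open>The iterates from the \<open>Suc n\<close>-th on agree in coefficient
    \<open>n\<close>, hence the index \<open>Suc n\<close>.\<close>
  define y where "y = (\<lambda>i. Abs_fps (\<lambda>n. Y (Suc n) i $ n))"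
  have y_Y: "fps_X ^ n dvd y i - Y n i" if "i \<in> I" for n i
    unfolding fps_X_power_dvd_iff
  proof (intro allI impI)
    fix m assume "m < n"
    then obtain k where "n = Suc m + k" using less_imp_Suc_add by auto
    then show "(y i - Y n i) $ m = 0"
      using step[OF that, of "Suc m" k] unfolding fps_X_power_dvd_iff by (auto simp: y_def)
  qed
  have y0: "fps_X dvd y i" if "i \<in> I" for i
    using y_Y[OF that, of 1] dvd_add[OF _ Y_dvd[OF that, of 1], of "y i - Y 1 i"] by simp
  show ?thesis
  proof
    show "fps_X dvd y i" if "i \<in> I" for i using y0 that .
    fix i assume i: "i \<in> I"
    show "y i = rhs c N y i"
    proof (rule fps_eq_if_fps_X_power_dvd)
      fix n
      have "fps_X ^ Suc n dvd rhs c N y i - rhs c N (Y n) i"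
        using y0 Y_dvd y_Y i assms by (intro rhs_contract) auto
      with y_Y[OF i, of "Suc n"]
      have "fps_X ^ Suc n dvd (y i - Y (Suc n) i) - (rhs c N y i - rhs c N (Y n) i)"
        by (rule dvd_diff)
      then have "fps_X ^ Suc n dvd y i - rhs c N y i" by (simp add: Y_Suc)
      then show "fps_X ^ n dvd y i - rhs c N y i"
        by (rule power_le_dvd) simp
    qed
  qed
qed

end

section \<open>Setting the parameter to 0\<close>

definition fps_eval0 :: "'a::comm_ring_1 poly fps \<Rightarrow> 'a fps" where
  "fps_eval0 f = Abs_fps (\<lambda>n. poly (f $ n) 0)"

lemma fps_eval0_nth [simp]: "fps_eval0 f $ n = poly (f $ n) 0"
  by (simp add: fps_eval0_def)

lemma fps_eval0_0 [simp]: "fps_eval0 0 = 0"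
  and fps_eval0_1 [simp]: "fps_eval0 1 = 1"
  and fps_eval0_X [simp]: "fps_eval0 fps_X = fps_X"
  and fps_eval0_const: "fps_eval0 (fps_const c) = fps_const (poly c 0)"
  and fps_eval0_of_bool [simp]: "fps_eval0 (of_bool P) = of_bool P"
  and fps_eval0_add: "fps_eval0 (f + g) = fps_eval0 f + fps_eval0 g"
  and fps_eval0_mult: "fps_eval0 (f * g) = fps_eval0 f * fps_eval0 g"
  by (auto intro!: fps_ext simp: fps_mult_nth poly_sum fps_X_def)

lemma fps_eval0_sum: "fps_eval0 (\<Sum>x\<in>A. f x) = (\<Sum>x\<in>A. fps_eval0 (f x))"
  by (induction A rule: infinite_finite_induct) (auto simp: fps_eval0_add)

lemma fps_eval0_prod_list: "fps_eval0 (prod_list xs) = prod_list (map fps_eval0 xs)"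
  by (induction xs) (auto simp: fps_eval0_mult)

lemma fps_eval0_power: "fps_eval0 (f ^ n) = fps_eval0 f ^ n"
  by (induction n) (auto simp: fps_eval0_mult)

lemma fps_eval0_of_poly: "fps_eval0 (fps_of_poly p) = fps_of_poly (map_poly (\<lambda>q. poly q 0) p)"
  by (rule fps_ext) (simp add: coeff_map_poly)

text \<open>Dividing the relation by the largest possible power of the parameter keeps it nontrivial
  when the parameter is set to 0.\<close>

lemma relation_at_0:
  fixes z :: "rat poly fps" and c :: "nat \<Rightarrow> rat poly poly"
  assumes "(\<Sum>k<m. fps_of_poly (c k) * z ^ k) = 0" and "k0 < m" "c k0 \<noteq> 0"
  shows "fps_algebraic (fps_eval0 z)"
proof -
  obtain j where "coeff (c k0) j \<noteq> 0"
    using \<open>c k0 \<noteq> 0\<close> leading_coeff_0_iff by blast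
  with assms(1) show ?thesis
  \<comment> \<open>The outer variable of \<open>c k\<close> is the power series variable, the inner
    one the parameter. One fixed nonzero coefficient loses a degree in the parameter with each
    division by it, so the divisions come to an end.\<close>
  proof (induction "degree (coeff (c k0) j)" arbitrary: c rule: less_induct)
    case less
    define r where "r = (\<lambda>p. map_poly (\<lambda>q :: rat poly. poly q 0) p)"
    show ?case
    proof (cases "\<exists>k<m. r (c k) \<noteq> 0")
      case True
      define ps where "ps = map (\<lambda>k. r (c k)) [0..<m]"
      have "\<exists>p\<in>set ps. p \<noteq> 0" using True by (auto simp: ps_def)
      moreover have "(\<Sum>i<length ps. fps_of_poly (ps ! i) * fps_eval0 z ^ i) =
          fps_eval0 (\<Sum>k<m. fps_of_poly (c k) * z ^ k)"
        by (simp add: ps_def fps_eval0_sum fps_eval0_mult fps_eval0_power fps_eval0_of_poly r_def)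
      ultimately show ?thesis
        unfolding fps_algebraic_def less.prems(1) by auto
    next
      case False
      have "\<exists>d. c k = smult [:0, 1:] d" if "k < m" for k
      proof -
        have "[:0, 1:] dvd coeff (c k) n" for n
        proof -
          have "poly (coeff (c k) n) 0 = coeff (r (c k)) n"
            by (simp add: r_def coeff_map_poly)
          also have "\<dots> = 0" using False that by simp
          finally show ?thesis by (simp add: poly_eq_0_iff_dvd)
        qed
        then have "[:[:0, 1:]:] dvd c k"
          by (simp add: const_poly_dvd_iff)
        then show ?thesis by (auto simp: dvd_def)
      qed
      then obtain d where d: "\<And>k. k < m \<Longrightarrow> c k = smult [:0, 1:] (d k)" by metis
      have "0 = (\<Sum>k<m. fps_of_poly (c k) * z ^ k)" using less.prems(1) by simp
      also have "\<dots> = (\<Sum>k<m. fps_const [:0, 1:] * (fps_of_poly (d k) * z ^ k))"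
        by (intro sum.cong) (auto simp: d fps_of_poly_smult mult.assoc)
      also have "\<dots> = fps_const [:0, 1:] * (\<Sum>k<m. fps_of_poly (d k) * z ^ k)"
        by (simp add: sum_distrib_left)
      finally have 1: "(\<Sum>k<m. fps_of_poly (d k) * z ^ k) = 0" by auto
      have c: "coeff (c k0) j = [:0, 1:] * coeff (d k0) j"
        using d[OF \<open>k0 < m\<close>] by simp
      then have 2: "coeff (d k0) j \<noteq> 0" using less.prems(2) by auto
      from 2 have "degree (coeff (d k0) j) < degree (coeff (c k0) j)"
        unfolding c by (subst degree_mult_eq) auto
      from less.hyps[OF this 1 2] show ?thesis .
    qed
  qed
qed

section \<open>Reduction of monomials to bounded length\<close>

lemma prod_list_map_factor:
  fixes y :: "'i \<Rightarrow> 'a::comm_monoid_mult"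
  assumes "N \<le> count_list w i"
  obtains w' where "prod_list (map y w) = y i ^ N * prod_list (map y w')"
    "set w' \<subseteq> set w" "length w = N + length w'"
proof -
  have "\<exists>w'. prod_list (map y w) = y i ^ N * prod_list (map y w') \<and>
    set w' \<subseteq> set w \<and> length w = N + length w'"
    using assms
  proof (induction w arbitrary: N)
    case (Cons a w)
    show ?case
    proof (cases "a = i \<and> N > 0")
      case True
      then obtain M where M: "N = Suc M" by (cases N) auto
      with Cons True obtain w' where "prod_list (map y w) = y i ^ M * prod_list (map y w')"
        "set w' \<subseteq> set w" "length w = M + length w'" by fastforce
      with True M show ?thesis by (intro exI[of _ w']) (auto simp: algebra_simps)
    next
      case False
      with Cons.prems have "N \<le> count_list w i" by (auto split: if_splits)
      with Cons.IH obtain w' where "prod_list (map y w) = y i ^ N * prod_list (map y w')"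
        "set w' \<subseteq> set w" "length w = N + length w'" by fastforce
      then show ?thesis by (intro exI[of _ "a # w'"]) (auto simp: algebra_simps)
    qed
  qed auto
  with that show ?thesis by blast
qed

text \<open>Adding the term \<open>s * y i ^ N\<close>, with \<open>N\<close> larger than every word length, makes the monomials
  of bounded degree span the algebra generated by the solution over the
  rational functions in \<open>s\<close> and the variable of the power series.\<close>

locale perturbed_system = word_system I T wd b
  for I :: "'i set" and T :: "'i \<Rightarrow> 't set" and wd b +
  fixes N :: nat and y :: "'i \<Rightarrow> rat poly fps"
  assumes N_ge: "N \<ge> 2"
    and wd_less: "\<And>i t. i \<in> I \<Longrightarrow> t \<in> T i \<Longrightarrow> length (wd t) < N"
    and y: "\<And>i. i \<in> I \<Longrightarrow> y i = rhs [:0, 1:] N y i"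
begin

text \<open>The bound is a pigeonhole bound: a longer word over \<open>I\<close> has a letter that
  occurs at least \<open>N\<close> times and can be reduced.\<close>

definition words :: "'i list set" where
  "words = {w. set w \<subseteq> I \<and> length w \<le> N * card I}"

abbreviation ev :: "'i list \<Rightarrow> rat poly fps" where "ev w \<equiv> prod_list (map y w)"

abbreviation S :: "rat poly fps" where "S \<equiv> fps_const [:0, 1:]"

text \<open>Membership in a span whose denominators are powers of the parameter, with denominators
  cleared so that all coefficients remain polynomials.\<close>

definition spanned :: "rat poly fps \<Rightarrow> bool" where
  "spanned z \<longleftrightarrow> (\<exists>e c. S ^ e * z = (\<Sum>w\<in>words. fps_of_poly (c w) * ev w))"

lemma finite_words: "finite words"
  unfolding words_def using finite_I by (rule finite_lists_length_le)

lemma S_power: "S ^ e = fps_of_poly ([:[:0, 1:]:] ^ e)"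
  by (simp add: fps_of_poly_power fps_of_poly_const)

lemma spanned_scale: "spanned z \<Longrightarrow> spanned (fps_of_poly p * z)"
proof -
  assume "spanned z"
  then obtain e c where "S ^ e * z = (\<Sum>w\<in>words. fps_of_poly (c w) * ev w)"
    by (auto simp: spanned_def)
  then have "S ^ e * (fps_of_poly p * z) = fps_of_poly p * (\<Sum>w\<in>words. fps_of_poly (c w) * ev w)"
    by (metis mult.left_commute)
  also have "\<dots> = (\<Sum>w\<in>words. fps_of_poly (p * c w) * ev w)"
    by (simp add: sum_distrib_left fps_of_poly_mult mult.assoc)
  finally show ?thesis unfolding spanned_def by (intro exI[of _ e] exI[of _ "\<lambda>w. p * c w"])
qed

lemma spanned_add:
  assumes "spanned z" "spanned z'" shows "spanned (z + z')"
proof -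
  obtain e c e' c' where c: "S ^ e * z = (\<Sum>w\<in>words. fps_of_poly (c w) * ev w)"
    and c': "S ^ e' * z' = (\<Sum>w\<in>words. fps_of_poly (c' w) * ev w)"
    using assms by (auto simp: spanned_def)
  define d where "d = (\<lambda>w. [:[:0, 1:]:] ^ e' * c w + [:[:0, 1:]:] ^ e * c' w)"
  have "S ^ (e + e') * (z + z') = S ^ e' * (S ^ e * z) + S ^ e * (S ^ e' * z')"
    by (simp add: power_add algebra_simps)
  also have "\<dots> = (\<Sum>w\<in>words. fps_of_poly (d w) * ev w)"
    unfolding c c' unfolding S_power d_def
    by (simp add: fps_of_poly_add fps_of_poly_mult sum_distrib_left sum.distrib ring_distribs mult.assoc)
  finally show ?thesis unfolding spanned_def by blast
qed

lemma spanned_0: "spanned 0"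
  unfolding spanned_def by (intro exI[of _ 0] exI[of _ "\<lambda>_. 0"]) simp

lemma spanned_sum: "(\<And>x. x \<in> A \<Longrightarrow> spanned (f x)) \<Longrightarrow> spanned (\<Sum>x\<in>A. f x)"
  by (induction A rule: infinite_finite_induct) (auto intro: spanned_0 spanned_add)

lemma spanned_diff: "spanned z \<Longrightarrow> spanned z' \<Longrightarrow> spanned (z - z')"
  using spanned_add[of z "fps_of_poly (-1) * z'"] spanned_scale[of z' "-1"]
  by (simp add: fps_of_poly_uminus)

lemma spanned_S_power: "spanned (S ^ e * z) \<Longrightarrow> spanned z"
  unfolding spanned_def
proof (elim exE)
  fix e' c assume "S ^ e' * (S ^ e * z) = (\<Sum>w\<in>words. fps_of_poly (c w) * ev w)"
  then show "\<exists>e c. S ^ e * z = (\<Sum>w\<in>words. fps_of_poly (c w) * ev w)"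
    by (intro exI[of _ "e' + e"] exI[of _ c]) (simp add: power_add mult.assoc del: fps_const_power)
qed

lemma spanned_ev: "set w \<subseteq> I \<Longrightarrow> spanned (ev w)"
proof (induction w rule: length_induct)
  case (1 w)
  show ?case
  proof (cases "w \<in> words")
    case True
    have "ev w = (\<Sum>v\<in>words. if v = w then ev v else 0)"
      using True finite_words by simp
    also have "\<dots> = (\<Sum>v\<in>words. fps_of_poly (of_bool (v = w)) * ev v)"
      by (intro sum.cong) auto
    finally show ?thesis
      unfolding spanned_def by (intro exI[of _ 0] exI[of _ "\<lambda>v. of_bool (v = w)"]) simp
  next
    case False
    have "\<exists>i\<in>I. N \<le> count_list w i"
    proof (rule ccontr)
      assume "\<not> ?thesis"
      then have "sum (count_list w) I \<le> (\<Sum>i\<in>I. N)" by (intro sum_mono) auto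
      with False 1 show False
        by (simp add: sum_count_set finite_I words_def mult.commute)
    qed
    then obtain i where i: "i \<in> I" "N \<le> count_list w i" by blast
    from prod_list_map_factor[OF i(2), of y]
    obtain w' where w': "ev w = y i ^ N * ev w'" "set w' \<subseteq> set w" "length w = N + length w'" .
    \<comment> \<open>The equation for \<open>y i\<close>, solved for its perturbation term: it
      replaces \<open>N\<close> letters of \<open>w\<close> by one letter, by none, or by a word
      shorter than \<open>N\<close>, so the induction on length applies to every resulting
      word.\<close>
    have "S * y i ^ N = y i - of_bool (b i) * fps_X - (\<Sum>t\<in>T i. ev (wd t))"
      using y[OF i(1)] by (simp add: rhs_def algebra_simps)
    then have "S ^ 1 * ev w = (y i - of_bool (b i) * fps_X - (\<Sum>t\<in>T i. ev (wd t))) * ev w'"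
      unfolding w'(1) by (metis mult.assoc power_one_right)
    also have "\<dots> = ev (i # w') - fps_of_poly (of_bool (b i) * [:0, 1:]) * ev w' - (\<Sum>t\<in>T i. ev (wd t @ w'))"
      by (simp add: algebra_simps sum_distrib_left sum_distrib_right)
    also have "spanned \<dots>"
    proof (intro spanned_diff spanned_sum spanned_scale)
      have IH: "spanned (ev v)" if "length v < length w" "set v \<subseteq> I" for v
        using 1(1) that by blast
      show "spanned (ev (i # w'))" "spanned (ev w')"
        using 1(2) w'(2,3) i(1) N_ge by (intro IH; force)+
      show "spanned (ev (wd t @ w'))" if "t \<in> T i" for t
        using 1(2) w'(2,3) wd_less[OF i(1) that] wd_I[OF i(1) that] by (intro IH) auto
    qed
    finally show ?thesis by (rule spanned_S_power)
  qed
qed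

text \<open>One more letter may exceed the length bound of \<open>words\<close>, and
  \<open>spanned_ev\<close> reduces the result again. Thus the span is closed under multiplication
  by the generators, which gives all powers.\<close>

lemma spanned_mult_y:
  assumes "spanned z" "i \<in> I" shows "spanned (z * y i)"
proof -
  obtain e c where c: "S ^ e * z = (\<Sum>w\<in>words. fps_of_poly (c w) * ev w)"
    using assms by (auto simp: spanned_def)
  have "S ^ e * (z * y i) = (\<Sum>w\<in>words. fps_of_poly (c w) * ev (i # w))"
  proof -
    have "S ^ e * (z * y i) = (S ^ e * z) * y i" by (rule mult.assoc[symmetric])
    then show ?thesis unfolding c by (simp add: sum_distrib_left mult_ac)
  qed
  also have "spanned \<dots>"
    using assms(2) by (intro spanned_sum spanned_scale spanned_ev) (auto simp: words_def)
  finally show ?thesis by (rule spanned_S_power)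
qed

lemma spanned_power:
  assumes "J \<subseteq> I"
  shows "spanned ((of_bool B + (\<Sum>i\<in>J. y i)) ^ k)"
proof (induction k)
  case 0
  show ?case using spanned_ev[of "[]"] by simp
next
  case (Suc k)
  let ?z = "of_bool B + (\<Sum>i\<in>J. y i)"
  have "?z ^ Suc k = fps_of_poly (of_bool B) * ?z ^ k + (\<Sum>i\<in>J. ?z ^ k * y i)"
    unfolding sum_distrib_left[symmetric] by (simp add: ring_distribs mult.commute)
  also have "spanned \<dots>"
    using assms Suc by (intro spanned_add spanned_scale spanned_sum spanned_mult_y) auto
  finally show ?case .
qed

lemma algebraic_at_0:
  assumes "J \<subseteq> I"
  shows "fps_algebraic (fps_eval0 (of_bool B + (\<Sum>i\<in>J. y i)))"
proof -
  define z where "z = of_bool B + (\<Sum>i\<in>J. y i)"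
  have "\<exists>e c. S ^ e * z ^ k = (\<Sum>w\<in>words. fps_of_poly (c w) * ev w)" for k
    using spanned_power[OF assms] unfolding z_def spanned_def .
  then obtain e c where ec: "\<And>k. S ^ e k * z ^ k = (\<Sum>w\<in>words. fps_of_poly (c k w) * ev w)"
    by metis
  \<comment> \<open>One power of \<open>z\<close> more than there are words, so the coefficient
    vectors of the powers are linearly dependent.\<close>
  define m where "m = Suc (card words)"
  have "\<exists>d. (\<exists>k\<in>{..<m}. d k \<noteq> 0) \<and> (\<forall>w\<in>words. (\<Sum>k\<in>{..<m}. d k * c k w) = 0)"
    using finite_words by (intro nontrivial_linear_relation) (auto simp: m_def)
  then obtain d k0 where d: "k0 < m" "d k0 \<noteq> 0" "\<And>w. w \<in> words \<Longrightarrow> (\<Sum>k<m. d k * c k w) = 0"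
    by auto
  \<comment> \<open>The denominators \<open>S ^ e k\<close> are absorbed into the coefficients,
    which leaves a relation between the plain powers of \<open>z\<close>; it stays nontrivial
    because the parameter is not a zero divisor.\<close>
  define d' where "d' = (\<lambda>k. d k * [:[:0, 1:]:] ^ e k)"
  have "(\<Sum>k<m. fps_of_poly (d' k) * z ^ k) = (\<Sum>k<m. fps_of_poly (d k) * (S ^ e k * z ^ k))"
    by (simp add: d'_def fps_of_poly_mult S_power mult.assoc del: fps_const_power)
  also have "\<dots> = (\<Sum>k<m. \<Sum>w\<in>words. fps_of_poly (d k * c k w) * ev w)"
    unfolding ec by (simp add: sum_distrib_left fps_of_poly_mult mult.assoc)
  also have "\<dots> = (\<Sum>w\<in>words. \<Sum>k<m. fps_of_poly (d k * c k w) * ev w)"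
    by (rule sum.swap)
  also have "\<dots> = (\<Sum>w\<in>words. fps_of_poly (\<Sum>k<m. d k * c k w) * ev w)"
    by (simp add: fps_of_poly_sum sum_distrib_right)
  also have "\<dots> = 0" using d(3) by simp
  finally have "(\<Sum>k<m. fps_of_poly (d' k) * z ^ k) = 0" .
  moreover have "d' k0 \<noteq> 0" using d(2) by (simp add: d'_def)
  ultimately show ?thesis using relation_at_0[of d' z m k0] d(1) unfolding z_def by blast
qed

end

context word_system
begin

theorem solution_algebraic:
  fixes f :: "'i \<Rightarrow> rat fps"
  assumes f0: "\<And>i. i \<in> I \<Longrightarrow> f i $ 0 = 0"
    and f: "\<And>i. i \<in> I \<Longrightarrow> f i = of_bool (b i) * fps_X + (\<Sum>t\<in>T i. prod_list (map f (wd t)))"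
    and "J \<subseteq> I"
  shows "fps_algebraic (of_bool B + (\<Sum>i\<in>J. f i))"
proof -
  define L where "L = (\<lambda>t. length (wd t)) ` (\<Union>i\<in>I. T i)"
  have "finite L" using finite_I finite_T by (auto simp: L_def)
  \<comment> \<open>The inserted 1 guarantees \<open>N \<ge> 2\<close> even if there are no words at
    all.\<close>
  define N where "N = Suc (Max (insert 1 L))"
  have N: "N \<ge> 2" "length (wd t) < N" if "i \<in> I" "t \<in> T i" for i t
  proof -
    have "x \<in> insert 1 L \<Longrightarrow> x < N" for x
      unfolding N_def using \<open>finite L\<close> by (intro le_imp_less_Suc Max_ge) auto
    moreover have "length (wd t) \<in> L" using that by (auto simp: L_def)
    ultimately show "N \<ge> 2" "length (wd t) < N" by force+
  qed
  have N2: "N \<ge> 2"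
    using \<open>finite L\<close> Max_ge[of "insert 1 L" 1] by (simp add: N_def)
  from solution_exists[OF N2, of "[:0, 1:] :: rat poly"]
  obtain y where y0: "\<And>i. i \<in> I \<Longrightarrow> fps_X dvd y i"
    and y: "\<And>i. i \<in> I \<Longrightarrow> y i = rhs ([:0, 1:] :: rat poly) N y i" by blast
  interpret perturbed_system I T wd b N y
    by unfold_locales (use N N2 y in auto)
  \<comment> \<open>Evaluation at 0 is a ring homomorphism that kills the perturbation term, so the
    evaluated solution solves the same system as \<open>f\<close>, and uniqueness identifies the
    two.\<close>
  have "fps_eval0 (y i) = f i" if "i \<in> I" for i
  proof (rule solution_unique[where c = 0 and N = N and y = "\<lambda>i. fps_eval0 (y i)" and z = f])
    show "fps_X dvd f i" if "i \<in> I" for i using f0 that by (simp add: fps_X_dvd_iff)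
    show "fps_X dvd fps_eval0 (y i)" if "i \<in> I" for i
      using y0[OF that] by (simp add: fps_X_dvd_iff)
    show "f i = rhs 0 N f i" if "i \<in> I" for i using f[OF that] by (simp add: rhs_def)
    show "fps_eval0 (y i) = rhs 0 N (\<lambda>i. fps_eval0 (y i)) i" if "i \<in> I" for i
      by (subst y[OF that])
        (simp add: rhs_def fps_eval0_add fps_eval0_sum fps_eval0_mult fps_eval0_const
          fps_eval0_prod_list fps_eval0_power comp_def)
  qed (use that N2 in auto)
  then have "fps_eval0 (of_bool B + (\<Sum>i\<in>J. y i)) = of_bool B + (\<Sum>i\<in>J. f i)"
    using \<open>J \<subseteq> I\<close> by (auto simp: fps_eval0_add fps_eval0_sum intro!: sum.cong)
  with algebraic_at_0[OF \<open>J \<subseteq> I\<close>, of B] show ?thesis by simp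
qed

end

section \<open>Segmentations and inflations\<close>

definition rank :: "nat set \<Rightarrow> nat \<Rightarrow> nat" where
  "rank U x = card {y \<in> U. y < x}"

text \<open>Standardisation: the permutation order-isomorphic to a list of distinct numbers. With
  it, consecutive pieces of a permutation can be handled as they stand, without renumbering.\<close>

definition std :: "nat list \<Rightarrow> nat list" where
  "std xs = map (rank (set xs)) xs"

lemma length_std [simp]: "length (std xs) = length xs"
  by (simp add: std_def)

lemma std_eq_Nil_iff [simp]: "std xs = [] \<longleftrightarrow> xs = []"
  by (simp add: std_def)

lemma rank_less_iff:
  assumes "finite U" "x \<in> U" "y \<in> U"
  shows "rank U x < rank U y \<longleftrightarrow> x < y"
proof -
  have *: "rank U x < rank U y" if "x < y" "x \<in> U" for x y
    unfolding rank_def using that assms(1) by (intro psubset_card_mono) auto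
  show ?thesis using *[of x y] *[of y x] assms by (cases x y rule: linorder_cases) auto
qed

lemma rank_less_card:
  assumes "finite U" "x \<in> U" shows "rank U x < card U"
  unfolding rank_def using assms by (intro psubset_card_mono) auto

lemma rank_image:
  assumes "finite U" shows "rank U ` U = {0..<card U}"
proof -
  have inj: "inj_on (rank U) U"
    by (rule linorder_inj_onI') (use rank_less_iff[OF assms] in \<open>metis less_irrefl\<close>)
  have "rank U ` U \<subseteq> {0..<card U}" using rank_less_card[OF assms] by auto
  then show ?thesis
    by (intro card_subset_eq) (auto simp: card_image[OF inj])
qed

lemma is_perm_std:
  assumes "distinct xs" shows "is_perm (std xs)"
proof -
  have "set (std xs) = {0..<length xs}"
    using rank_image[of "set xs"] distinct_card[OF assms] by (simp add: std_def)
  then show ?thesis by (auto simp: is_perm_def intro: card_distinct)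
qed

lemma rank_perm:
  assumes "is_perm p" "x \<in> set p" shows "rank (set p) x = x"
proof -
  have "set p = {0..<length p}" using assms(1) by (simp add: is_perm_def)
  then have "{y \<in> set p. y < x} = {0..<x}" using assms(2) by auto
  then show ?thesis by (simp add: rank_def)
qed

lemma std_perm: "is_perm p \<Longrightarrow> std p = p"
  by (simp add: std_def rank_perm map_idI)

lemma order_iso_std: "order_iso xs (std xs)"
  by (auto simp: order_iso_def std_def rank_less_iff)

lemma rank_nth:
  assumes "distinct xs"
  shows "rank (set xs) x = card {j. j < length xs \<and> xs ! j < x}"
proof -
  have "{y \<in> set xs. y < x} = (!) xs ` {j. j < length xs \<and> xs ! j < x}"
    by (auto simp: in_set_conv_nth)
  then show ?thesis
    using assms by (simp add: rank_def card_image inj_on_nth)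
qed

lemma std_order_iso:
  assumes "order_iso xs ys" "distinct xs" "distinct ys"
  shows "std xs = std ys"
proof (rule nth_equalityI)
  show "length (std xs) = length (std ys)" using assms(1) by (simp add: order_iso_def)
  fix i assume "i < length (std xs)"
  with assms(1) have "{j. j < length xs \<and> xs ! j < xs ! i} = {j. j < length ys \<and> ys ! j < ys ! i}"
    by (auto simp: order_iso_def)
  then show "std xs ! i = std ys ! i"
    using \<open>i < length (std xs)\<close> assms by (simp add: std_def rank_nth order_iso_def)
qed

lemma std_map_add: "std (map (\<lambda>x. x + c) xs) = std xs"
proof -
  have "{y \<in> (\<lambda>x. x + c) ` set xs. y < x + c} = (\<lambda>x. x + c) ` {y \<in> set xs. y < x}" for x
    by auto
  then have "rank ((\<lambda>x. x + c) ` set xs) (x + c) = rank (set xs) x" for x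
    by (simp add: rank_def card_image)
  then show ?thesis by (simp add: std_def)
qed

section \<open>Intervals and simplicity on unnumbered lists\<close>

abbreviation all_rel :: "(nat \<Rightarrow> nat \<Rightarrow> bool) \<Rightarrow> nat list \<Rightarrow> nat list \<Rightarrow> bool" where
  "all_rel R xs ys \<equiv> \<forall>x\<in>set xs. \<forall>y\<in>set ys. R x y"

abbreviation separated :: "nat list \<Rightarrow> nat list \<Rightarrow> bool" where
  "separated xs ys \<equiv> all_rel (<) xs ys \<or> all_rel (>) xs ys"

definition separates :: "nat \<Rightarrow> nat list \<Rightarrow> bool" where
  "separates u vs \<longleftrightarrow> (\<forall>v\<in>set vs. u < v) \<or> (\<forall>v\<in>set vs. v < u)"

text \<open>An outside value is below all of \<open>vs\<close> or above all of it, so the same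
  outside values count towards the rank of every entry of \<open>vs\<close>: the ranks are those
  within \<open>vs\<close>, shifted by a constant.\<close>

lemma interval_stdI:
  assumes "distinct (us @ vs @ ws)" "vs \<noteq> []"
    and sep: "\<And>u. u \<in> set us \<union> set ws \<Longrightarrow> separates u vs"
  shows "is_interval (std (us @ vs @ ws)) (length us) (length us + length vs - 1)"
proof -
  let ?xs = "us @ vs @ ws"
  let ?U = "set ?xs"
  define L where "L = {u \<in> ?U - set vs. u < hd vs}"
  have rank: "rank ?U v = card L + rank (set vs) v" if "v \<in> set vs" for v
  proof -
    have "{y \<in> ?U. y < v} = L \<union> {y \<in> set vs. y < v}"
    proof -
      have "hd vs \<in> set vs" using \<open>vs \<noteq> []\<close> by simp
      then have "u < v \<longleftrightarrow> u < hd vs" if "u \<in> set us \<union> set ws" for u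
        using sep[OF that] \<open>v \<in> set vs\<close> unfolding separates_def by (meson order.asym)
      with assms(1) show ?thesis by (auto simp: L_def)
    qed
    moreover have "L \<inter> {y \<in> set vs. y < v} = {}" by (auto simp: L_def)
    ultimately show ?thesis by (simp add: rank_def card_Un_disjoint L_def)
  qed
  have vs: "card (set vs) = length vs" using assms(1) by (simp add: distinct_card)
  have "(!) (std ?xs) ` {length us..length us + length vs - 1} = rank ?U ` set vs"
  proof -
    have "std ?xs ! i = rank ?U (vs ! (i - length us))"
      if "i \<in> {length us..length us + length vs - 1}" for i
    proof -
      have i: "length us \<le> i" "i - length us < length vs" "i < length ?xs"
        using that assms(2) by (cases vs; auto)+
      then have "std ?xs ! i = rank ?U (?xs ! i)" unfolding std_def by (intro nth_map)
      with i show ?thesis by (simp add: nth_append)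
    qed
    then have "(!) (std ?xs) ` {length us..length us + length vs - 1} =
      (\<lambda>i. rank ?U (vs ! (i - length us))) ` {length us..length us + length vs - 1}"
      by (intro image_cong) auto
    also have "\<dots> = (\<lambda>i. rank ?U (vs ! (i - length us))) ` ((\<lambda>i. i + length us) ` {0..<length vs})"
      using assms(2) by (intro arg_cong2[of _ _ _ _ "(`)"] refl)
        (cases vs; auto simp: image_iff intro!: bexI[of _ "_ - length us"])
    also have "\<dots> = rank ?U ` ((!) vs ` {0..<length vs})"
      by (simp only: image_image add_diff_cancel_right')
    also have "(!) vs ` {0..<length vs} = set vs"
      by (auto simp: in_set_conv_nth)
    finally show ?thesis .
  qed
  also have "\<dots> = (+) (card L) ` (rank (set vs) ` set vs)"
    using rank by (auto simp: image_image)
  also have "\<dots> = {card L..card L + (length us + length vs - 1 - length us)}"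
    unfolding rank_image[OF finite_set] vs using assms(2) by (cases vs) (auto simp: image_add_atLeastLessThan)
  finally show ?thesis
    using assms(2) unfolding is_interval_def by (cases vs) auto
qed

text \<open>Simplicity restated so that later arguments need no index ranges: it suffices to exhibit
  a stretch of the list whose value range no other entry enters.\<close>

lemma simple_std_trivial:
  assumes "simple_perm (std (us @ vs @ ws))" "distinct (us @ vs @ ws)" "length vs \<ge> 2"
    and "\<And>u. u \<in> set us \<union> set ws \<Longrightarrow> separates u vs"
  shows "us = []" "ws = []"
proof -
  have "is_interval (std (us @ vs @ ws)) (length us) (length us + length vs - 1)"
    using assms by (intro interval_stdI) auto
  with assms(1,3) have "length us = 0 \<and> length us + length vs - 1 = length us + length vs + length ws - 1"
    unfolding simple_perm_def by fastforce
  with assms(3) have "length us = 0" "length ws = 0" by linarith+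
  then show "us = []" "ws = []" by auto
qed

lemma interval_stdE:
  assumes "is_interval (std xs) a b" "distinct xs"
  obtains us vs ws where "xs = us @ vs @ ws" "length us = a" "length vs = Suc (b - a)"
    "\<forall>u\<in>set us \<union> set ws. separates u vs"
proof -
  define us where "us = take a xs"
  define vs where "vs = take (Suc (b - a)) (drop a xs)"
  define ws where "ws = drop (Suc b) xs"
  from assms(1) obtain c where ab: "a \<le> b" "b < length xs"
    and c: "(!) (std xs) ` {a..b} = {c..c + (b - a)}"
    unfolding is_interval_def length_std by blast
  have "drop (Suc (b - a)) (drop a xs) = ws" using ab by (simp add: ws_def)
  then have xs: "us @ vs @ ws = xs" unfolding us_def vs_def by (metis append_take_drop_id)
  have len: "length us = a" "length vs = Suc (b - a)" using ab by (auto simp: us_def vs_def)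
  have vs_nth: "set vs = (!) xs ` {a..b}"
  proof -
    have "set vs = (!) (drop a xs) ` {0..<Suc (b - a)}"
      unfolding vs_def by (rule nth_image[symmetric]) (use ab in auto)
    also have "\<dots> = (\<lambda>i. xs ! (a + i)) ` {0..<Suc (b - a)}"
      using ab by (intro image_cong) auto
    also have "\<dots> = (!) xs ` ((+) a ` {0..<Suc (b - a)})"
      by (simp only: image_image)
    also have "(+) a ` {0..<Suc (b - a)} = {a..b}"
      using ab by (auto simp: image_add_atLeastLessThan)
    finally show ?thesis .
  qed
  have ranks: "rank (set xs) ` set vs = {c..c + (b - a)}"
  proof -
    have "rank (set xs) ` set vs = (\<lambda>i. rank (set xs) (xs ! i)) ` {a..b}"
      unfolding vs_nth by (simp only: image_image)
    also have "\<dots> = (!) (std xs) ` {a..b}"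
      using ab by (intro image_cong) (auto simp: std_def)
    finally show ?thesis using c by simp
  qed
  have "separates u vs" if u: "u \<in> set us \<union> set ws" for u
  proof -
    have set_xs: "set xs = set us \<union> set vs \<union> set ws" by (auto simp: xs[symmetric])
    then have vs_xs: "set vs \<subseteq> set xs" and u_xs: "u \<in> set xs" using u by auto
    have "distinct (us @ vs @ ws)" by (simp only: xs assms(2))
    then have u_vs: "u \<notin> set vs" using u unfolding distinct_append by auto
    \<comment> \<open>Ranks are injective, so the rank of \<open>u\<close> avoids the value interval
      and lies on one side of it.\<close>
    have "rank (set xs) u \<notin> rank (set xs) ` set vs"
    proof (intro notI, elim imageE)
      fix v assume v: "rank (set xs) u = rank (set xs) v" "v \<in> set vs"
      with vs_xs have "v \<in> set xs" by blast
      with v(1) u_xs rank_less_iff[of "set xs" u v] rank_less_iff[of "set xs" v u] have "u = v" by simp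
      with v(2) u_vs show False by simp
    qed
    then consider "rank (set xs) u < c" | "c + (b - a) < rank (set xs) u"
      unfolding ranks by fastforce
    then show ?thesis
    proof cases
      case 1
      have "u < v" if "v \<in> set vs" for v
      proof -
        have "rank (set xs) v \<in> {c..c + (b - a)}" using ranks that by blast
        with 1 have "rank (set xs) u < rank (set xs) v" by simp
        with that vs_xs u_xs show ?thesis by (simp add: rank_less_iff subsetD)
      qed
      then show ?thesis by (simp add: separates_def)
    next
      case 2
      have "v < u" if "v \<in> set vs" for v
      proof -
        have "rank (set xs) v \<in> {c..c + (b - a)}" using ranks that by blast
        with 2 have "rank (set xs) v < rank (set xs) u" by simp
        with that vs_xs u_xs show ?thesis by (simp add: rank_less_iff subsetD)
      qed
      then show ?thesis by (simp add: separates_def)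
    qed
  qed
  then show ?thesis using that[OF xs[symmetric] len] by blast
qed

text \<open>Sum decomposability for \<open>R = (<)\<close>, skew decomposability for \<open>R = (>)\<close>.\<close>

definition dec :: "(nat \<Rightarrow> nat \<Rightarrow> bool) \<Rightarrow> nat list \<Rightarrow> bool" where
  "dec R p \<longleftrightarrow> (\<exists>xs ys. p = xs @ ys \<and> xs \<noteq> [] \<and> ys \<noteq> [] \<and> all_rel R xs ys)"

lemma dec_map:
  assumes "\<And>x y. x \<in> set xs \<Longrightarrow> y \<in> set xs \<Longrightarrow> R (f x) (f y) \<longleftrightarrow> R x y"
  shows "dec R (map f xs) \<longleftrightarrow> dec R xs"
proof
  assume "dec R (map f xs)"
  then obtain us vs where "map f xs = us @ vs" "us \<noteq> []" "vs \<noteq> []" "all_rel R us vs"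
    by (auto simp: dec_def)
  then show "dec R xs"
    using assms unfolding dec_def map_eq_append_conv
    by (elim exE conjE) (intro exI conjI, assumption, auto)
next
  assume "dec R xs"
  then obtain us vs where *: "xs = us @ vs" "us \<noteq> []" "vs \<noteq> []" "all_rel R us vs"
    by (auto simp: dec_def)
  then show "dec R (map f xs)"
    using assms unfolding dec_def by (intro exI[of _ "map f us"] exI[of _ "map f vs"]) auto
qed

lemma dec_std: "R = (<) \<or> R = (>) \<Longrightarrow> dec R (std xs) \<longleftrightarrow> dec R xs"
  unfolding std_def by (rule dec_map) (auto simp: rank_less_iff)

lemma perm_length_2:
  assumes "is_perm [x, y]" shows "(x, y) = (0, 1) \<or> (x, y) = (1, 0)"
proof -
  have *: "x \<noteq> y" "{x, y} = {0..<2}"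
    using assms unfolding is_perm_def by (simp_all add: numeral_2_eq_2)
  then have "x \<in> {0..<2}" "y \<in> {0..<2}" by blast+
  with \<open>x \<noteq> y\<close> show ?thesis by auto
qed

text \<open>Each of the two parts of the decomposition is a proper interval, so simplicity shrinks
  it to a single entry.\<close>

lemma simple_dec_length_2:
  assumes "simple_perm s" "dec R s" "R = (<) \<or> R = (>)"
  obtains x y where "s = [x, y]" "R x y"
proof -
  obtain xs ys where s: "s = xs @ ys" "xs \<noteq> []" "ys \<noteq> []" "all_rel R xs ys"
    using assms(2) by (auto simp: dec_def)
  have perm: "is_perm s" "distinct s" using assms(1) by (auto simp: simple_perm_def is_perm_def)
  have std: "simple_perm (std (xs @ ys))" "distinct (xs @ ys)"
    using assms(1) perm s(1) by (auto simp: std_perm)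
  have "separates u xs" if "u \<in> set ys" for u
    using s(4) assms(3) that by (auto simp: separates_def)
  then have "\<not> length xs \<ge> 2"
    using simple_std_trivial(2)[of "[]" xs ys] std s(3) by auto
  moreover have "separates u ys" if "u \<in> set xs" for u
    using s(4) assms(3) that by (auto simp: separates_def)
  then have "\<not> length ys \<ge> 2"
    using simple_std_trivial(1)[of xs ys "[]"] std s(2) by auto
  moreover have "length xs \<noteq> 0" "length ys \<noteq> 0" using s(2,3) by auto
  ultimately have "length xs = Suc 0" "length ys = Suc 0" by linarith+
  then obtain x y where "xs = [x]" "ys = [y]" by (auto simp: length_Suc_conv)
  with s show ?thesis by (intro that[of x y]) auto
qed

lemma simple_dec_less_iff: "simple_perm s \<Longrightarrow> dec (<) s \<longleftrightarrow> s = [0, 1]"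
  and simple_dec_greater_iff: "simple_perm s \<Longrightarrow> dec (>) s \<longleftrightarrow> s = [1, 0]"
proof -
  have "dec (<) [0, 1]" "dec (>) [1, 0]"
    unfolding dec_def by (rule exI[of _ "[0]"], rule exI[of _ "[1]"], simp)
      (rule exI[of _ "[1]"], rule exI[of _ "[0]"], simp)
  moreover assume s: "simple_perm s"
  then have "is_perm s" by (simp add: simple_perm_def)
  have "s = [0, 1]" if dec: "dec (<) s"
  proof -
    obtain x y where "s = [x, y]" "x < y"
      using simple_dec_length_2[OF s dec] by blast
    with perm_length_2[of x y] \<open>is_perm s\<close> show ?thesis by simp
  qed
  moreover have "s = [1, 0]" if dec: "dec (>) s"
  proof -
    obtain x y where "s = [x, y]" "x > y"
      using simple_dec_length_2[OF s dec] by blast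
    with perm_length_2[of x y] \<open>is_perm s\<close> show ?thesis by simp
  qed
  ultimately show "dec (<) s \<longleftrightarrow> s = [0, 1]" "dec (>) s \<longleftrightarrow> s = [1, 0]" by blast+
qed

lemma simple_perm_01: "simple_perm [0, 1]" and simple_perm_10: "simple_perm [1, 0]"
proof -
  have "b = a \<or> a = 0 \<and> b = length s - 1" if "is_interval s a b" "length s = 2" for s a b
  proof -
    have "a \<le> b" "b < 2" using that unfolding is_interval_def by auto
    with that(2) show ?thesis by linarith
  qed
  moreover have "is_perm [0, 1]" "is_perm [1, 0]"
    by (simp_all add: is_perm_def numeral_2_eq_2 atLeast0_lessThan_Suc insert_commute)
  ultimately show "simple_perm [0, 1]" "simple_perm [1, 0]"
    unfolding simple_perm_def by simp_all
qed

section \<open>Cutting a list into interval blocks\<close>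

text \<open>An inflation seen from its result. Comparing blocks as lists instead of by position
  loses nothing: nonempty blocks of a list with distinct entries are pairwise different.\<close>

definition segmentation :: "nat list list \<Rightarrow> bool" where
  "segmentation xss \<longleftrightarrow> [] \<notin> set xss \<and> distinct (concat xss) \<and>
     (\<forall>A\<in>set xss. \<forall>B\<in>set xss. A \<noteq> B \<longrightarrow> separated A B)"

text \<open>The heads represent their blocks; in a segmentation, separation makes any other choice
  of representatives give the same pattern.\<close>

abbreviation block_pattern :: "nat list list \<Rightarrow> nat list" where
  "block_pattern xss \<equiv> std (map hd xss)"

lemma separated_hd:
  assumes "separated A B" "x \<in> set A" "y \<in> set B" "R x y" "R = (<) \<or> R = (>)"
  shows "all_rel R A B"
  using assms by (meson less_asym)

lemma segmentation_append:
  assumes "segmentation (xss @ yss)" "A \<in> set xss" "B \<in> set yss"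
  shows "set A \<inter> set B = {}" "separated A B"
proof -
  show "set A \<inter> set B = {}" using assms by (auto simp: segmentation_def)
  moreover have "A \<noteq> []" using assms by (auto simp: segmentation_def)
  ultimately have "A \<noteq> B" by auto
  with assms show "separated A B" by (auto simp: segmentation_def)
qed

lemma segmentation_distinct:
  assumes "segmentation xss" shows "distinct xss" "distinct (map hd xss)"
proof -
  have 1: "removeAll [] xss = xss" using assms by (simp add: segmentation_def)
  have 2: "distinct (removeAll [] xss)"
    using assms unfolding segmentation_def distinct_concat_iff by blast
  with 1 show "distinct xss" by simp
  have "inj_on hd (set xss)"
  proof (rule inj_onI, rule ccontr)
    fix A B assume "A \<in> set xss" "B \<in> set xss" "hd A = hd B" "A \<noteq> B"
    moreover from this assms have "A \<noteq> []" "B \<noteq> []" by (auto simp: segmentation_def)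
    then have "hd A \<in> set A" "hd B \<in> set B" by simp_all
    moreover have "separated A B" using calculation assms by (auto simp: segmentation_def)
    ultimately show False by (metis less_irrefl)
  qed
  with \<open>distinct xss\<close> show "distinct (map hd xss)" by (simp add: distinct_map)
qed

lemma concat_eq_appendE:
  assumes "concat xss = c @ d" "c \<noteq> []"
  obtains us p q vs where "xss = us @ (p @ q) # vs" "c = concat us @ p" "d = q @ concat vs" "p \<noteq> []"
  using assms
proof (induction xss arbitrary: c thesis)
  case (Cons A xss)
  have "A @ concat xss = c @ d" using Cons.prems by simp
  then obtain e where "A = c @ e \<and> e @ concat xss = d \<or> A @ e = c \<and> concat xss = e @ d \<and> e \<noteq> []"
    unfolding append_eq_append_conv2 by (metis append_Nil2 append_Nil)
  then consider "A = c @ e" "d = e @ concat xss" | "c = A @ e" "concat xss = e @ d" "e \<noteq> []"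
    by blast
  then show ?case
  proof cases
    case 1
    then show ?thesis using Cons.prems(1)[of "[]" c e xss] Cons.prems(3) by simp
  next
    case 2
    from Cons.IH[OF _ 2(2,3)] obtain us p q vs
      where "xss = us @ (p @ q) # vs" "e = concat us @ p" "d = q @ concat vs" "p \<noteq> []" by blast
    then show ?thesis using Cons.prems(1)[of "A # us" p q vs] 2(1) by simp
  qed
qed simp

text \<open>A cut of the entries may fall inside a block, but by separation one comparison between
  two blocks decides all of them, so the cut can be moved to a boundary of that block.\<close>

lemma dec_concat_iff:
  assumes seg: "segmentation xss" and len: "length xss \<ge> 2" and R: "R = (<) \<or> R = (>)"
  shows "dec R (concat xss) \<longleftrightarrow> dec R (map hd xss)"
proof
  assume "dec R (map hd xss)"
  then obtain us vs where uv: "xss = us @ vs" "us \<noteq> []" "vs \<noteq> []" "all_rel R (map hd us) (map hd vs)"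
    unfolding dec_def map_eq_append_conv by blast
  have ne: "[] \<notin> set us" "[] \<notin> set vs" using seg uv by (auto simp: segmentation_def)
  have "all_rel R A B" if "A \<in> set us" "B \<in> set vs" for A B
  proof (rule separated_hd[OF _ _ _ _ R])
    show "separated A B" using seg that unfolding uv(1) by (rule segmentation_append)
    show "hd A \<in> set A" "hd B \<in> set B" using ne that by (metis hd_in_set)+
    show "R (hd A) (hd B)" using uv(4) that by auto
  qed
  then have "all_rel R (concat us) (concat vs)" by auto
  moreover have "concat us \<noteq> []" "concat vs \<noteq> []" using ne uv(2,3) by (cases us; cases vs; auto)+
  ultimately show "dec R (concat xss)" unfolding dec_def uv(1) by (metis concat_append)
next
  assume "dec R (concat xss)"
  then obtain xs ys where xy: "concat xss = xs @ ys" "xs \<noteq> []" "ys \<noteq> []" "all_rel R xs ys"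
    by (auto simp: dec_def)
  from concat_eq_appendE[OF xy(1,2)] obtain us p q vs where
    s: "xss = us @ (p @ q) # vs" "xs = concat us @ p" "ys = q @ concat vs" "p \<noteq> []" by blast
  \<comment> \<open>The cut meets the block \<open>p @ q\<close>. If this block is the last one it
    goes to the right part, otherwise to the left one; as there are at least two blocks, both parts
    are nonempty.\<close>
  obtain us' vs' where uv: "xss = us' @ vs'" "us' \<noteq> []" "vs' \<noteq> []"
    "\<And>A. A \<in> set us' \<Longrightarrow> \<exists>x\<in>set A. x \<in> set xs" "\<And>B. B \<in> set vs' \<Longrightarrow> \<exists>y\<in>set B. y \<in> set ys"
  proof (cases "vs = []")
    case True
    show ?thesis
    proof (rule that[of us "[p @ q]"])
      have "q \<noteq> []" using True s xy by auto
      then show "\<exists>y\<in>set B. y \<in> set ys" if "B \<in> set [p @ q]" for B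
        using that s by (cases q) auto
      show "\<exists>x\<in>set A. x \<in> set xs" if "A \<in> set us" for A
      proof -
        have "A \<noteq> []" using seg s that by (auto simp: segmentation_def)
        then have "hd A \<in> set A" by simp
        with that show ?thesis by (intro bexI[of _ "hd A"]) (auto simp: s)
      qed
    qed (use s True len in auto)
  next
    case False
    show ?thesis
    proof (rule that[of "us @ [p @ q]" vs])
      show "\<exists>x\<in>set A. x \<in> set xs" if "A \<in> set (us @ [p @ q])" for A
      proof -
        have "A \<noteq> []" using seg s that by (auto simp: segmentation_def)
        then have "hd A \<in> set A" by simp
        with that \<open>p \<noteq> []\<close> show ?thesis by (intro bexI[of _ "hd A"]) (auto simp: s)
      qed
      show "\<exists>y\<in>set B. y \<in> set ys" if "B \<in> set vs" for B
      proof -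
        have "B \<noteq> []" using seg s that by (auto simp: segmentation_def)
        then have "hd B \<in> set B" by simp
        with that show ?thesis by (intro bexI[of _ "hd B"]) (auto simp: s)
      qed
    qed (use s False in auto)
  qed
  have "R (hd A) (hd B)" if AB: "A \<in> set us'" "B \<in> set vs'" for A B
  proof -
    obtain x y where "x \<in> set A" "y \<in> set B" "R x y" using uv(4,5) xy(4) AB by meson
    then have "all_rel R A B"
      using segmentation_append(2)[of us' vs' A B] seg uv(1) AB R by (intro separated_hd) auto
    moreover have "A \<noteq> []" "B \<noteq> []" using AB seg uv(1) by (auto simp: segmentation_def)
    ultimately show ?thesis by simp
  qed
  then show "dec R (map hd xss)"
    unfolding dec_def uv(1) using uv(2,3)
    by (intro exI[of _ "map hd us'"] exI[of _ "map hd vs'"]) auto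
qed

text \<open>A block of another segmentation that ends inside a later block is an interval meeting
  several consecutive blocks, so simplicity of the pattern forces it to meet them all; cutting off
  the last block then gives a second interval.\<close>

lemma segmentation_no_overrun:
  assumes x: "segmentation xss" "xss = ps @ a # as" "simple_perm (block_pattern xss)"
    and y: "segmentation yss" "yss = ps @ (a @ c) # bs" "length yss \<ge> 2"
    and "c \<noteq> []" and eq: "concat xss = concat yss"
    and ndec: "\<not> dec (<) (concat xss)" "\<not> dec (>) (concat xss)"
  shows False
proof -
  let ?J = "a @ c"
  have "concat as = c @ concat bs" using eq x(2) y(2) by simp
  \<comment> \<open>The block \<open>?J\<close> of \<open>yss\<close> covers \<open>a\<close> and
    all of \<open>us\<close> and ends within the block \<open>p @ q\<close> or exactly at its
    end.\<close>
  from concat_eq_appendE[OF this \<open>c \<noteq> []\<close>] obtain us p q vs where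
    as: "as = us @ (p @ q) # vs" "c = concat us @ p" "concat bs = q @ concat vs" "p \<noteq> []" by blast
  have ne: "A \<noteq> []" if "A \<in> set xss" for A using x(1) that by (auto simp: segmentation_def)
  have xss: "xss = ps @ (a # us @ [p @ q]) @ vs" using x(2) as(1) by simp
  have J: "separates z ?J" if z: "z \<in> set (concat xss)" "z \<notin> set ?J" for z
  proof -
    from z eq obtain A where A: "A \<in> set yss" "z \<in> set A" by auto
    moreover have "?J \<in> set yss" using y(2) by simp
    moreover have "A \<noteq> ?J" using A z by blast
    ultimately have "separated A ?J" using y(1) unfolding segmentation_def by blast
    then show ?thesis using A(2) unfolding separates_def by blast
  qed
  \<comment> \<open>A block of \<open>xss\<close> disjoint from \<open>?J\<close> lies on one side
    of \<open>?J\<close> and therefore on the same side of every block that meets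
    \<open>?J\<close>.\<close>
  have sep: "separates (hd A) (map hd Bs)"
    if A: "A \<in> set xss" "set A \<inter> set ?J = {}"
      and Bs: "\<And>B. B \<in> set Bs \<Longrightarrow> B \<in> set xss \<and> set B \<inter> set ?J \<noteq> {}" for A Bs
  proof -
    have hdA: "hd A \<in> set A" using ne[OF A(1)] by simp
    then have "hd A \<in> set (concat xss)" "hd A \<notin> set ?J" using A by auto
    then have J': "separates (hd A) ?J" by (rule J)
    have all: "all_rel R A B" if "B \<in> set Bs" "\<forall>z\<in>set ?J. R (hd A) z" "R = (<) \<or> R = (>)" for B R
    proof -
      from Bs[OF that(1)] obtain z where z: "z \<in> set B" "z \<in> set ?J" "B \<in> set xss" by blast
      then have "A \<noteq> B" using A(2) by blast
      then have "separated A B" using z A(1) x(1) unfolding segmentation_def by blast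
      then show ?thesis using separated_hd[OF _ hdA z(1) _ that(3)] that(2) z(2) by blast
    qed
    have hdB: "hd B \<in> set B" if "B \<in> set Bs" for B using ne Bs[OF that] by simp
    show ?thesis
      using J' unfolding separates_def[of _ ?J]
    proof
      assume "\<forall>v\<in>set ?J. hd A < v"
      then have "hd A < hd B" if "B \<in> set Bs" for B using all[OF that, of "(<)"] hdA hdB[OF that] by blast
      then show ?thesis by (simp add: separates_def)
    next
      assume "\<forall>v\<in>set ?J. v < hd A"
      then have "hd A > hd B" if "B \<in> set Bs" for B using all[OF that, of "(>)"] hdA hdB[OF that] by blast
      then show ?thesis by (simp add: separates_def)
    qed
  qed
  have meet: "B \<in> set xss \<and> set B \<inter> set ?J \<noteq> {}" if "B \<in> set (a # us @ [p @ q])" for B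
  proof -
    have "B \<in> set xss" using that xss by auto
    moreover have "B \<noteq> []" using ne calculation by blast
    then have "set B \<inter> set ?J \<noteq> {}"
    proof -
      have "B = a \<or> B \<in> set us \<or> B = p @ q" using that by auto
      then have "hd B \<in> set ?J"
        using \<open>B \<noteq> []\<close> as(2,4) by (elim disjE) (auto intro: hd_in_set bexI[of _ B])
      with \<open>B \<noteq> []\<close> show ?thesis using hd_in_set by blast
    qed
    ultimately show ?thesis by blast
  qed
  have dist: "distinct (map hd ps @ map hd (a # us @ [p @ q]) @ map hd vs)"
    using segmentation_distinct(2)[OF x(1)] unfolding xss by simp
  have simple: "simple_perm (std (map hd ps @ map hd (a # us @ [p @ q]) @ map hd vs))"
    using x(3) unfolding xss by simp
  have "separates u (map hd (a # us @ [p @ q]))" if u: "u \<in> set (map hd ps) \<union> set (map hd vs)" for u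
  proof -
    from u obtain A where A: "A \<in> set ps \<union> set vs" "u = hd A" by auto
    have "set A \<inter> set ?J = {}"
    proof -
      have "distinct (concat xss)" using x(1) by (simp add: segmentation_def)
      then show ?thesis using A(1) as(2) unfolding xss by auto
    qed
    moreover have "A \<in> set xss" using A(1) xss by auto
    ultimately show ?thesis using sep[of A] meet A(2) by blast
  qed
  \<comment> \<open>At least two blocks meet \<open>?J\<close>, so simplicity of the pattern leaves
    no others.\<close>
  from simple_std_trivial[OF simple dist _ this] have "ps = []" "vs = []" by auto
  \<comment> \<open>A further block of \<open>yss\<close> has to fit behind \<open>?J\<close>, so
    \<open>?J\<close> stops strictly inside the last block of \<open>xss\<close>.\<close>
  have "bs \<noteq> []" using y(2,3) \<open>ps = []\<close> by auto
  moreover have "[] \<notin> set bs" using y(1,2) by (auto simp: segmentation_def)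
  ultimately have "concat bs \<noteq> []" by (cases bs) auto
  then have "q \<noteq> []" using as(3) \<open>vs = []\<close> by simp
  have xss': "xss = a # us @ [p @ q]" using xss \<open>ps = []\<close> \<open>vs = []\<close> by simp
  \<comment> \<open>Since \<open>hd q\<close> is outside \<open>?J\<close>, the last block lies on
    one side of all blocks before it; for nonempty \<open>us\<close> these would form a proper
    interval of the pattern with at least two entries.\<close>
  have "us = []"
  proof (rule ccontr)
    assume "us \<noteq> []"
    have hq: "hd q \<in> set (p @ q)" using \<open>q \<noteq> []\<close> by simp
    have "hd q \<in> set (concat xss)" using hq xss' by simp
    moreover have "hd q \<notin> set ?J"
    proof -
      have "distinct (concat xss)" using x(1) by (simp add: segmentation_def)
      moreover have "hd q \<in> set q" using \<open>q \<noteq> []\<close> by simp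
      ultimately show ?thesis using as(2) unfolding xss' by auto
    qed
    ultimately have Jq: "separates (hd q) ?J" by (rule J)
    have sepq: "separates (hd (p @ q)) (map hd (a # us))"
    proof -
      have all: "R (hd (p @ q)) (hd B)"
        if B: "B \<in> set (a # us)" and R: "\<forall>z\<in>set ?J. R (hd q) z" "R = (<) \<or> R = (>)" for B R
      proof -
        have "B \<noteq> []" using ne B xss' by auto
        then have hB: "hd B \<in> set B" by simp
        have "separated (p @ q) B"
          using segmentation_append(2)[of "a # us" "[p @ q]" B "p @ q"] x(1) B xss' by auto
        moreover have "hd B \<in> set ?J" using hB B as(2) by auto
        ultimately have "all_rel R (p @ q) B"
          using separated_hd[OF _ hq hB _ R(2)] R(1) by blast
        moreover have "hd (p @ q) \<in> set (p @ q)" using \<open>q \<noteq> []\<close> by (intro hd_in_set) simp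
        ultimately show ?thesis using hB by blast
      qed
      show ?thesis
        using Jq all[of _ "(<)"] all[of _ "(>)"] unfolding separates_def by (simp only: set_map) blast
    qed
    have "simple_perm (std ([] @ map hd (a # us) @ [hd (p @ q)]))"
      "distinct ([] @ map hd (a # us) @ [hd (p @ q)])"
      using simple dist \<open>ps = []\<close> \<open>vs = []\<close> by simp_all
    moreover have "length (map hd (a # us)) \<ge> 2" using \<open>us \<noteq> []\<close> by (cases us) auto
    ultimately have "[hd (p @ q)] = []" using sepq
      by (intro simple_std_trivial(2)[of "[]" "map hd (a # us)" "[hd (p @ q)]"]) auto
    then show False by simp
  qed
  \<comment> \<open>Two separated blocks remain, and these are a sum or skew decomposition of the
    whole list.\<close>
  then have "concat xss = a @ (p @ q)" using xss' by simp
  moreover have "separated a (p @ q)"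
    using segmentation_append(2)[of "[a]" "[p @ q]" a "p @ q"] x(1) xss' \<open>us = []\<close> by simp
  moreover have "a \<noteq> []" "p @ q \<noteq> []" using ne xss' by auto
  ultimately show False using ndec unfolding dec_def by metis
qed

lemma segmentation_unique:
  assumes x: "segmentation xss" "simple_perm (block_pattern xss)" "length xss \<ge> 2"
    and y: "segmentation yss" "simple_perm (block_pattern yss)" "length yss \<ge> 2"
    and eq: "concat xss = concat yss"
    and ndec: "\<not> dec (<) (concat xss)" "\<not> dec (>) (concat xss)"
  shows "xss = yss"
proof (rule ccontr)
  assume "xss \<noteq> yss"
  \<comment> \<open>Behind the common prefix, the first blocks begin at the same position and
    differ, so one is a proper prefix of the other: the situation of
    \<open>segmentation_no_overrun\<close>.\<close>
  obtain ps xss' yss' where ps: "xss = ps @ xss'" "yss = ps @ yss'"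
    "xss' = [] \<or> yss' = [] \<or> hd xss' \<noteq> hd yss'"
    using longest_common_prefix[of xss yss] by blast
  have ne: "[] \<notin> set xss'" "[] \<notin> set yss'" using x(1) y(1) ps by (auto simp: segmentation_def)
  have eq': "concat xss' = concat yss'" using eq ps by simp
  have Nil: "concat zs = [] \<Longrightarrow> [] \<notin> set zs \<Longrightarrow> zs = []" for zs :: "nat list list"
    by (cases zs) auto
  have "xss' \<noteq> []" "yss' \<noteq> []"
    using Nil[of xss'] Nil[of yss'] ne eq' ps(1,2) \<open>xss \<noteq> yss\<close> by auto
  then obtain a as b bs where ab: "xss' = a # as" "yss' = b # bs" "a \<noteq> b"
    using ps(3) by (cases xss'; cases yss') auto
  then obtain c where "a @ c = b \<and> c \<noteq> [] \<or> b @ c = a \<and> c \<noteq> []"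
    using eq' by (auto simp: append_eq_append_conv2)
  then show False
  proof
    assume "a @ c = b \<and> c \<noteq> []"
    then show False
      using segmentation_no_overrun[OF x(1) _ x(2) y(1) _ y(3) _ eq ndec, of ps a as c bs] ps ab by simp
  next
    assume "b @ c = a \<and> c \<noteq> []"
    then show False
      using segmentation_no_overrun[OF y(1) _ y(2) x(1) _ x(3) _ eq[symmetric], of ps b bs c as]
        ps ab ndec eq by simp
  qed
qed

text \<open>Inflations of the simple permutations 01 and 10 are the only ambiguous ones; requiring an indecomposable first block
  makes them unique.\<close>

definition canonical :: "nat list list \<Rightarrow> bool" where
  "canonical xss \<longleftrightarrow> segmentation xss \<and> length xss \<ge> 2 \<and> simple_perm (block_pattern xss) \<and>
     (block_pattern xss = [0, 1] \<longrightarrow> \<not> dec (<) (hd xss)) \<and> (block_pattern xss = [1, 0] \<longrightarrow> \<not> dec (>) (hd xss))"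

text \<open>Decomposability depends on the list alone, so two segmentations of one list with simple
  patterns agree on whether the pattern is 01, 10 or neither. This splits the uniqueness proof into
  cases.\<close>

lemma dec_concat_pattern_iff:
  assumes "segmentation xss" "length xss \<ge> 2" "simple_perm (block_pattern xss)"
  shows "dec (<) (concat xss) \<longleftrightarrow> block_pattern xss = [0, 1]"
    and "dec (>) (concat xss) \<longleftrightarrow> block_pattern xss = [1, 0]"
  using dec_concat_iff[OF assms(1,2)] dec_std[of _ "map hd xss"]
    simple_dec_less_iff[OF assms(3)] simple_dec_greater_iff[OF assms(3)] by blast+

text \<open>If the cuts differed, the shorter first part would decompose the longer one.\<close>

lemma split_unique:
  assumes "A @ B = A' @ B'" "all_rel R A B" "all_rel R A' B'"
    and "\<not> dec R A" "\<not> dec R A'" "A \<noteq> []" "A' \<noteq> []"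
  shows "A = A'"
proof -
  obtain us where "A = A' @ us \<and> us @ B = B' \<or> A @ us = A' \<and> B = us @ B'"
    using assms(1) unfolding append_eq_append_conv2 by blast
  then show ?thesis
  proof
    assume *: "A = A' @ us \<and> us @ B = B'"
    then have "all_rel R A' us" using assms(3) by auto
    then have "us = []" using assms(4,7) * unfolding dec_def by blast
    with * show ?thesis by simp
  next
    assume *: "A @ us = A' \<and> B = us @ B'"
    then have "all_rel R A us" using assms(2) by auto
    then have "us = []" using assms(5,6) * unfolding dec_def by blast
    with * show ?thesis by simp
  qed
qed

lemma two_segments:
  assumes "segmentation xss" "length (block_pattern xss) = 2"
    and "dec R (block_pattern xss)" "R = (<) \<or> R = (>)"
  obtains A B where "xss = [A, B]" "all_rel R A B" "A \<noteq> []" "B \<noteq> []"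
proof -
  obtain A B where xss: "xss = [A, B]" using assms(2) by (auto simp: length_Suc_conv numeral_2_eq_2)
  have ne: "A \<noteq> []" "B \<noteq> []" using assms(1) xss by (auto simp: segmentation_def)
  have "dec R [hd A, hd B]" using assms(3,4) xss by (simp add: dec_std)
  then obtain us vs where "[hd A, hd B] = us @ vs" "us \<noteq> []" "vs \<noteq> []" "all_rel R us vs"
    unfolding dec_def by blast
  then have "R (hd A) (hd B)" by (auto simp: Cons_eq_append_conv)
  moreover have "separated A B" using segmentation_append(2)[of "[A]" "[B]"] assms(1) xss by simp
  ultimately have "all_rel R A B" using ne assms(4) by (intro separated_hd[of A B "hd A" "hd B" R]) auto
  with that xss ne show ?thesis by blast
qed

lemma canonical_unique:
  assumes x: "canonical xss" and y: "canonical yss" and eq: "concat xss = concat yss"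
  shows "xss = yss"
proof -
  have x': "segmentation xss" "length xss \<ge> 2" "simple_perm (block_pattern xss)"
    and y': "segmentation yss" "length yss \<ge> 2" "simple_perm (block_pattern yss)"
    using x y unfolding canonical_def by blast+
  note qx = dec_concat_pattern_iff[OF x'] and qy = dec_concat_pattern_iff[OF y']
  have two: "xss = yss" if dec: "dec R (concat xss)" and R: "R = (<) \<or> R = (>)"
    and two: "length (block_pattern xss) = 2" "length (block_pattern yss) = 2"
    and ndec: "\<not> dec R (hd xss)" "\<not> dec R (hd yss)" for R
  proof -
    have "dec R (block_pattern xss)" "dec R (block_pattern yss)"
      using dec dec_concat_iff[OF x'(1,2) R] dec_concat_iff[OF y'(1,2) R]
      unfolding dec_std[OF R] eq by blast+
    then obtain A B A' B' where AB: "xss = [A, B]" "all_rel R A B" "A \<noteq> []" "B \<noteq> []"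
      and AB': "yss = [A', B']" "all_rel R A' B'" "A' \<noteq> []" "B' \<noteq> []"
      by (elim two_segments[OF x'(1) two(1) _ R] two_segments[OF y'(1) two(2) _ R])
    have "A = A'"
    proof (rule split_unique)
      show "A @ B = A' @ B'" using AB(1) AB'(1) eq by simp
      show "all_rel R A B" "all_rel R A' B'" "A \<noteq> []" "A' \<noteq> []" by fact+
      show "\<not> dec R A" "\<not> dec R A'" using ndec AB(1) AB'(1) by simp_all
    qed
    with AB(1) AB'(1) eq show ?thesis by simp
  qed
  consider "dec (<) (concat xss)" | "dec (>) (concat xss)"
    | "\<not> dec (<) (concat xss)" "\<not> dec (>) (concat xss)" by blast
  then show ?thesis
  proof cases
    case 1
    then have "block_pattern xss = [0, 1]" "block_pattern yss = [0, 1]"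
      using qx(1) qy(1) unfolding eq by blast+
    moreover from this have "\<not> dec (<) (hd xss)" "\<not> dec (<) (hd yss)"
      using x y unfolding canonical_def by blast+
    moreover from calculation have "length (block_pattern xss) = 2" "length (block_pattern yss) = 2"
      by (simp_all only:) simp_all
    ultimately show ?thesis by (intro two[OF 1]) simp_all
  next
    case 2
    then have "block_pattern xss = [1, 0]" "block_pattern yss = [1, 0]"
      using qx(2) qy(2) unfolding eq by blast+
    moreover from this have "\<not> dec (>) (hd xss)" "\<not> dec (>) (hd yss)"
      using x y unfolding canonical_def by blast+
    moreover from calculation have "length (block_pattern xss) = 2" "length (block_pattern yss) = 2"
      by (simp_all only:) simp_all
    ultimately show ?thesis by (intro two[OF 2]) simp_all
  next
    case 3
    then show ?thesis by (rule segmentation_unique[OF x'(1,3,2) y'(1,3,2) eq])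
  qed
qed

section \<open>Existence of canonical segmentations\<close>

lemma is_perm_dist: "is_perm p \<Longrightarrow> distinct p"
  by (simp add: is_perm_def)

lemma segmentation_two:
  assumes "distinct (xs @ ys)" "xs \<noteq> []" "ys \<noteq> []" "separated xs ys"
  shows "segmentation [xs, ys]"
  using assms unfolding segmentation_def by auto

text \<open>Lifts an interval of the pattern to the list: the blocks over it fuse into a single
  block. This is the coarsening step towards a simple pattern.\<close>

lemma segmentation_merge:
  assumes seg: "segmentation (us @ vs @ ws)" "vs \<noteq> []"
    and sep: "\<And>A. A \<in> set us \<union> set ws \<Longrightarrow> separates (hd A) (map hd vs)"
  shows "segmentation (us @ [concat vs] @ ws)"
proof -
  have ne: "[] \<notin> set us" "[] \<notin> set vs" "[] \<notin> set ws"
    using seg by (auto simp: segmentation_def)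
  then have "concat vs \<noteq> []" using \<open>vs \<noteq> []\<close> by (cases vs) auto
  have main: "all_rel (<) A (concat vs) \<or> all_rel (>) A (concat vs)" if A: "A \<in> set us \<union> set ws" for A
  proof -
    have hdA: "hd A \<in> set A" using ne A by (intro hd_in_set) auto
    have AB: "all_rel R A B" if B: "B \<in> set vs" and R: "R (hd A) (hd B)" "R = (<) \<or> R = (>)" for B R
    proof (rule separated_hd[OF _ hdA _ R])
      show "hd B \<in> set B" using ne B by (intro hd_in_set) auto
      have "separated A B \<or> separated B A"
        using A B seg(1) segmentation_append(2)[of us "vs @ ws" A B]
          segmentation_append(2)[of "us @ vs" ws B A] by auto
      then show "separated A B" by blast
    qed
    show ?thesis
      using sep[OF A] AB[of _ "(<)"] AB[of _ "(>)"] unfolding separates_def by (simp only: set_map set_concat) blast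
  qed
  have "separated A B" if "A \<in> set (us @ [concat vs] @ ws)" "B \<in> set (us @ [concat vs] @ ws)" "A \<noteq> B" for A B
  proof -
    have "A \<in> set us \<union> set ws \<or> A = concat vs" "B \<in> set us \<union> set ws \<or> B = concat vs" using that by auto
    moreover have "separated A B" if "A \<in> set us \<union> set ws" "B \<in> set us \<union> set ws"
    proof -
      have "A \<in> set (us @ vs @ ws)" "B \<in> set (us @ vs @ ws)" using that by auto
      with \<open>A \<noteq> B\<close> show ?thesis using seg(1) unfolding segmentation_def by blast
    qed
    ultimately show ?thesis using main[of A] main[of B] \<open>A \<noteq> B\<close> by blast
  qed
  moreover have "distinct (concat (us @ [concat vs] @ ws))"
    using seg(1) by (simp add: segmentation_def)
  ultimately show ?thesis
    using ne \<open>concat vs \<noteq> []\<close> unfolding segmentation_def by auto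
qed

lemma segmentation_simple_exists:
  assumes "distinct p" "length p \<ge> 2"
  obtains xss where "segmentation xss" "concat xss = p" "length xss \<ge> 2" "simple_perm (block_pattern xss)"
proof -
  define P where "P = (\<lambda>xss. segmentation xss \<and> concat xss = p \<and> length xss \<ge> 2)"
  have concat: "concat (map (\<lambda>x. [x]) p) = p" by (induction p) auto
  have "separated A B" if AB: "A \<in> set (map (\<lambda>x. [x]) p)" "B \<in> set (map (\<lambda>x. [x]) p)" "A \<noteq> B" for A B
  proof -
    obtain x y where "A = [x]" "B = [y]" using AB(1,2) by auto
    with AB(3) show ?thesis by (cases x y rule: linorder_cases) auto
  qed
  moreover have "[] \<notin> set (map (\<lambda>x. [x]) p)" by auto
  ultimately have "segmentation (map (\<lambda>x. [x]) p)"
    unfolding segmentation_def concat using assms(1) by blast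
  then have "P (map (\<lambda>x. [x]) p)"
    using assms(2) concat by (simp add: P_def)
  \<comment> \<open>Among segmentations with at least two blocks, one with the fewest has a simple
    pattern, since a nontrivial interval of the pattern would allow a merge that keeps two blocks.
    The cut into single entries is the starting candidate.\<close>
  from ex_has_least_nat[of P, OF this, of length]
  obtain xss where xss: "P xss" and min: "\<And>yss. P yss \<Longrightarrow> length xss \<le> length yss" by blast
  have dist: "distinct (map hd xss)" using xss segmentation_distinct(2) unfolding P_def by blast
  have "simple_perm (block_pattern xss)"
    unfolding simple_perm_def
  proof (intro conjI allI impI)
    show "is_perm (block_pattern xss)" using dist by (rule is_perm_std)
    fix a b assume int: "is_interval (block_pattern xss) a b"
    then have ab: "a \<le> b" "b < length xss" unfolding is_interval_def by auto
    from interval_stdE[OF int dist] obtain us vs ws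
      where uvw: "map hd xss = us @ vs @ ws" "length us = a" "length vs = Suc (b - a)"
        "\<forall>u\<in>set us \<union> set ws. separates u vs" .
    from map_eq_append_conv[THEN iffD1, OF uvw(1)] obtain us' zs
      where us': "xss = us' @ zs" "us = map hd us'" "vs @ ws = map hd zs" by (elim exE conjE)
    from append_eq_map_conv[THEN iffD1, OF us'(3)] obtain vs' ws'
      where vs': "zs = vs' @ ws'" "vs = map hd vs'" "ws = map hd ws'" by (elim exE conjE)
    have xss': "xss = us' @ vs' @ ws'" using us'(1) vs'(1) by simp
    show "b = a \<or> a = 0 \<and> b = length (block_pattern xss) - 1"
    proof (rule ccontr)
      assume *: "\<not> ?thesis"
      have len: "length us' = a" "length vs' = Suc (b - a)"
        using uvw(2,3) us'(2) vs'(2) by simp_all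
      define yss where "yss = us' @ [concat vs'] @ ws'"
      have "segmentation yss"
        unfolding yss_def
      proof (rule segmentation_merge)
        show "segmentation (us' @ vs' @ ws')" using xss xss' by (simp add: P_def)
        show "separates (hd A) (map hd vs')" if "A \<in> set us' \<union> set ws'" for A
          using uvw(4) that unfolding us'(2) vs'(2,3) by auto
      qed (use len in auto)
      moreover have "concat yss = p" using xss by (simp add: P_def yss_def xss')
      moreover have "length us' + length vs' + length ws' = length xss" by (simp add: xss')
      then have "length yss \<ge> 2" "length yss < length xss"
        using * len ab by (auto simp: yss_def Suc_le_eq)
      ultimately have "P yss" unfolding P_def by blast
      then show False using min[of yss] \<open>length yss < length xss\<close> by simp
    qed
  qed
  then show ?thesis using that xss unfolding P_def by blast
qed

lemma block_pattern_two:
  assumes "distinct (xs @ ys)" "xs \<noteq> []" "ys \<noteq> []" "all_rel R xs ys" "R = (<) \<or> R = (>)"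
  shows "block_pattern [xs, ys] = (if R = (<) then [0, 1] else [1, 0])"
proof -
  have h: "hd xs \<in> set xs" "hd ys \<in> set ys" using assms by auto
  then have R: "R (hd xs) (hd ys)" using assms by blast
  have "std [x, y] = [0, 1]" if "x < y" for x y
  proof -
    have "{z \<in> {x, y}. z < x} = {}" "{z \<in> {x, y}. z < y} = {x}" using that by auto
    then show ?thesis by (simp add: std_def rank_def)
  qed
  moreover have "std [x, y] = [1, 0]" if "x > y" for x y
  proof -
    have "{z \<in> {x, y}. z < x} = {y}" "{z \<in> {x, y}. z < y} = {}" using that by auto
    then show ?thesis by (simp add: std_def rank_def)
  qed
  moreover have "(<) \<noteq> ((>) :: nat \<Rightarrow> nat \<Rightarrow> bool)" by (metis zero_less_one less_asym)
  ultimately show ?thesis using R assms(5) by auto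
qed

lemma canonical_exists:
  assumes "distinct p" "length p \<ge> 2"
  obtains xss where "canonical xss" "concat xss = p"
proof -
  have dec: "\<exists>xss. canonical xss \<and> concat xss = p" if d: "dec R p" and R: "R = (<) \<or> R = (>)" for R
  proof -
    \<comment> \<open>The shortest possible first part is indecomposable, as
      \<open>canonical\<close> demands.\<close>
    define P where "P = (\<lambda>xs. \<exists>ys. p = xs @ ys \<and> xs \<noteq> [] \<and> ys \<noteq> [] \<and> all_rel R xs ys)"
    obtain xs0 where "P xs0" using d by (auto simp: dec_def P_def)
    from ex_has_least_nat[of P, OF this, of length]
    obtain xs where xs: "P xs" and min: "\<And>xs'. P xs' \<Longrightarrow> length xs \<le> length xs'" by blast
    from xs obtain ys where ys: "p = xs @ ys" "xs \<noteq> []" "ys \<noteq> []" "all_rel R xs ys"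
      by (auto simp: P_def)
    have "\<not> dec R xs"
    proof
      assume "dec R xs"
      then obtain us vs where uv: "xs = us @ vs" "us \<noteq> []" "vs \<noteq> []" "all_rel R us vs"
        by (auto simp: dec_def)
      have "all_rel R us (vs @ ys)" using uv(1,4) ys(4) by auto
      then have "P us" unfolding P_def using uv(1-3) ys(1) by (intro exI[of _ "vs @ ys"]) auto
      with min[of us] uv show False by auto
    qed
    have bp: "block_pattern [xs, ys] = (if R = (<) then [0, 1] else [1, 0])"
      using assms(1) ys R by (intro block_pattern_two) auto
    have ne: "(<) \<noteq> ((>) :: nat \<Rightarrow> nat \<Rightarrow> bool)" by (metis zero_less_one less_asym)
    have "segmentation [xs, ys]"
      using assms(1) ys R by (intro segmentation_two) auto
    then have "canonical [xs, ys]"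
      unfolding canonical_def bp using R \<open>\<not> dec R xs\<close> simple_perm_01 simple_perm_10 ne by auto
    with ys(1) show ?thesis by (intro exI[of _ "[xs, ys]"]) simp
  qed
  show ?thesis
  proof (cases "dec (<) p \<or> dec (>) p")
    case True
    then show ?thesis using dec that by blast
  next
    case False
    from segmentation_simple_exists[OF assms] obtain xss where
      xss: "segmentation xss" "concat xss = p" "length xss \<ge> 2" "simple_perm (block_pattern xss)" .
    with False have "canonical xss"
      unfolding canonical_def using dec_concat_pattern_iff[OF xss(1,3,4)] by blast
    with xss(2) that show ?thesis by blast
  qed
qed

section \<open>Inflations as segmentations\<close>

definition offset :: "nat list \<Rightarrow> nat list list \<Rightarrow> nat \<Rightarrow> nat" where
  "offset s as i = (\<Sum>j\<in>{j. j < length s \<and> s ! j < s ! i}. length (as ! j))"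

definition segments :: "nat list \<Rightarrow> nat list list \<Rightarrow> nat list list" where
  "segments s as = map (\<lambda>i. map (\<lambda>x. x + offset s as i) (as ! i)) [0..<length s]"

lemma inflate_eq_concat: "inflate s as = concat (segments s as)"
  by (simp add: inflate_def segments_def offset_def)

lemma length_segments [simp]: "length (segments s as) = length s"
  by (simp add: segments_def)

lemma segments_nth: "i < length s \<Longrightarrow> segments s as ! i = map (\<lambda>x. x + offset s as i) (as ! i)"
  by (simp add: segments_def)

lemma valid_blocks_nth:
  assumes "valid_blocks s as" "i < length s"
  shows "is_perm (as ! i)" "as ! i \<noteq> []"
  using assms by (auto simp: valid_blocks_def)

text \<open>Standardising undoes the shifts and so recovers the blocks of an inflation from its
  segments; injectivity of \<open>inflate\<close> on \<open>decomps\<close> rests on this.\<close>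

lemma map_std_segments:
  assumes "valid_blocks s as" shows "map std (segments s as) = as"
  using assms valid_blocks_nth[OF assms]
  by (intro nth_equalityI) (auto simp: segments_nth std_map_add std_perm valid_blocks_def)

lemma offset_add_le:
  assumes "i < length s" "j < length s" "s ! i < s ! j"
  shows "offset s as i + length (as ! i) \<le> offset s as j"
proof -
  have "offset s as i + length (as ! i) =
      (\<Sum>k\<in>insert i {k. k < length s \<and> s ! k < s ! i}. length (as ! k))"
    by (subst sum.insert) (auto simp: offset_def)
  also have "\<dots> \<le> offset s as j"
    unfolding offset_def using assms by (intro sum_mono2) auto
  finally show ?thesis .
qed

lemma segments_less:
  assumes "valid_blocks s as" "i < length s" "j < length s" "s ! i < s ! j"
  shows "all_rel (<) (segments s as ! i) (segments s as ! j)"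
proof -
  have "x < length (as ! i)" if "x \<in> set (as ! i)" for x
    using valid_blocks_nth[OF assms(1,2)] that by (auto simp: is_perm_def)
  then show ?thesis
    using offset_add_le[OF assms(2-4), of as] assms(2,3) by (force simp: segments_nth)
qed

text \<open>Distinctness of the entries comes from the hypothesis on the inflation, which wreath
  closure supplies in use; separation comes from the offsets, which put the block of a smaller entry
  below that of a larger one.\<close>

lemma segmentation_segments:
  assumes v: "valid_blocks s as" and s: "is_perm s" and p: "is_perm (inflate s as)"
  shows "segmentation (segments s as)" "block_pattern (segments s as) = s"
proof -
  let ?xs = "segments s as"
  have ne: "?xs ! i \<noteq> []" if "i < length s" for i
    using valid_blocks_nth[OF v that] that by (simp add: segments_nth)
  show seg: "segmentation ?xs"
    unfolding segmentation_def
  proof (intro conjI ballI impI)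
    show "[] \<notin> set ?xs" using ne by (auto simp: in_set_conv_nth)
    show "distinct (concat ?xs)" using p by (simp add: inflate_eq_concat is_perm_def)
    fix A B assume "A \<in> set ?xs" "B \<in> set ?xs" "A \<noteq> B"
    then obtain i j where ij: "A = ?xs ! i" "B = ?xs ! j" "i < length s" "j < length s" "i \<noteq> j"
      by (auto simp: in_set_conv_nth)
    then have "s ! i \<noteq> s ! j" using s by (simp add: is_perm_def nth_eq_iff_index_eq)
    then show "separated A B"
      using segments_less[OF v, of i j] segments_less[OF v, of j i] ij by (metis nat_neq_iff)
  qed
  have hd_in: "hd (?xs ! i) \<in> set (?xs ! i)" if "i < length s" for i using ne[OF that] by simp
  have less: "hd (?xs ! i) < hd (?xs ! j)" if "i < length s" "j < length s" "s ! i < s ! j" for i j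
    using segments_less[OF v that] hd_in that(1,2) by blast
  have "order_iso (map hd ?xs) s"
    unfolding order_iso_def
  proof (intro conjI allI impI)
    fix i j assume "i < length (map hd ?xs)" "j < length (map hd ?xs)"
    then have ij: "i < length s" "j < length s" by auto
    have "s ! i = s ! j \<Longrightarrow> i = j" using ij s by (simp add: is_perm_def nth_eq_iff_index_eq)
    then show "map hd ?xs ! i < map hd ?xs ! j \<longleftrightarrow> s ! i < s ! j"
      using less[of i j] less[of j i] ij by (cases "s ! i" "s ! j" rule: linorder_cases) auto
  qed simp
  then show "block_pattern ?xs = s"
    using std_order_iso[of "map hd ?xs" s] segmentation_distinct(2)[OF seg] s
    by (simp add: std_perm is_perm_def)
qed

text \<open>In a permutation counted from 0, a value equals the number of smaller values. For an
  entry of block \<open>i\<close> these are the entries of the lower blocks, which add up to the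
  offset, and the smaller entries of its own block, which give its rank there.\<close>

lemma inflate_block_pattern:
  assumes seg: "segmentation xss" and p: "is_perm (concat xss)"
  shows "inflate (block_pattern xss) (map std xss) = concat xss"
proof -
  let ?s = "block_pattern xss" and ?as = "map std xss"
  have "segments ?s ?as = xss"
  proof (rule nth_equalityI)
    fix i assume "i < length (segments ?s ?as)"
    then have i: "i < length xss" by simp
    define K where "K = {j. j < length xss \<and> hd (xss ! j) < hd (xss ! i)}"
    have ne: "xss ! j \<noteq> []" if "j < length xss" for j
      using seg nth_mem[OF that] unfolding segmentation_def by (intro notI) simp
    have dist: "distinct (xss ! j)" if "j < length xss" for j
      using seg nth_mem[OF that] unfolding segmentation_def distinct_concat_iff by blast
    have hd_in: "hd (xss ! j) \<in> set (xss ! j)" if "j < length xss" for j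
      using ne[OF that] by simp
    have disj: "set (xss ! j) \<inter> set (xss ! k) = {}" "separated (xss ! j) (xss ! k)"
      if "j < length xss" "k < length xss" "j \<noteq> k" for j k
    proof -
      have neq: "xss ! j \<noteq> xss ! k"
        using that segmentation_distinct(1)[OF seg] by (simp add: nth_eq_iff_index_eq)
      then show sep: "separated (xss ! j) (xss ! k)"
        using seg nth_mem[OF that(1)] nth_mem[OF that(2)] unfolding segmentation_def by blast
      show "set (xss ! j) \<inter> set (xss ! k) = {}"
      proof (rule ccontr)
        assume "\<not> ?thesis"
        then obtain x where "x \<in> set (xss ! j)" "x \<in> set (xss ! k)" by blast
        with sep have "x < x" by blast
        then show False by simp
      qed
    qed
    have "{j. j < length ?s \<and> ?s ! j < ?s ! i} = K"
      using i by (auto simp: K_def std_def rank_less_iff)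
    then have off: "offset ?s ?as i = (\<Sum>j\<in>K. length (xss ! j))"
      by (auto simp: offset_def K_def intro!: sum.cong)
    have "rank (set (xss ! i)) x + offset ?s ?as i = x" if x: "x \<in> set (xss ! i)" for x
    proof -
      have rel: "all_rel (<) (xss ! j) (xss ! i)" if "j \<in> K" for j
      proof -
        have "j < length xss" "j \<noteq> i" "hd (xss ! j) < hd (xss ! i)" using that by (auto simp: K_def)
        with disj(2)[of j i] hd_in[of j] hd_in[of i] i show ?thesis
          by (intro separated_hd[of _ _ "hd (xss ! j)" "hd (xss ! i)"]) simp_all
      qed
      have rel': "all_rel (>) (xss ! j) (xss ! i)" if "j < length xss" "j \<notin> K" "j \<noteq> i" for j
      proof -
        have "hd (xss ! j) \<noteq> hd (xss ! i)"
          using disj(1)[OF that(1) i that(3)] hd_in[OF that(1)] hd_in[OF i] by (metis disjoint_iff)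
        with that have "hd (xss ! j) > hd (xss ! i)" by (simp add: K_def)
        with that disj(2)[of j i] hd_in[OF that(1)] hd_in[OF i] i show ?thesis
          by (intro separated_hd[of _ _ "hd (xss ! j)" "hd (xss ! i)"]) simp_all
      qed
      have "{y \<in> set (concat xss). y < x} = {y \<in> set (xss ! i). y < x} \<union> (\<Union>j\<in>K. set (xss ! j))"
        (is "?l = ?r")
      proof (intro equalityI subsetI)
        fix y assume "y \<in> ?l"
        then obtain j where j: "j < length xss" "y \<in> set (xss ! j)" "y < x"
          by (auto simp: in_set_conv_nth[of _ xss])
        show "y \<in> ?r"
        proof (cases "j = i \<or> j \<in> K")
          case False
          with j(1) have "y > x" using rel'[of j] j(2) x by auto
          with j(3) show ?thesis by simp
        qed (use j in auto)
      next
        fix y assume "y \<in> ?r"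
        then consider "y \<in> set (xss ! i)" "y < x" | j where "j \<in> K" "y \<in> set (xss ! j)" by blast
        then show "y \<in> ?l"
        proof cases
          case 1
          then show ?thesis using nth_mem[OF i] by auto
        next
          case 2
          then have "y < x" using rel[OF 2(1)] x by blast
          moreover have "xss ! j \<in> set xss" using 2(1) by (simp add: K_def)
          ultimately show ?thesis using 2(2) by auto
        qed
      qed
      moreover have "i \<notin> K" by (simp add: K_def)
      then have "{y \<in> set (xss ! i). y < x} \<inter> (\<Union>j\<in>K. set (xss ! j)) = {}"
        using disj(1)[OF i] unfolding K_def by blast
      moreover have "card (\<Union>j\<in>K. set (xss ! j)) = (\<Sum>j\<in>K. card (set (xss ! j)))"
        using disj(1) by (intro card_UN_disjoint) (auto simp: K_def)
      moreover have "(\<Sum>j\<in>K. card (set (xss ! j))) = (\<Sum>j\<in>K. length (xss ! j))"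
        using dist by (intro sum.cong) (simp_all add: K_def distinct_card)
      moreover have "finite K" by (simp add: K_def)
      ultimately have "rank (set (concat xss)) x = rank (set (xss ! i)) x + offset ?s ?as i"
        unfolding rank_def off by (simp add: card_Un_disjoint)
      moreover have "x \<in> set (concat xss)" using x nth_mem[OF i] by auto
      ultimately show ?thesis using rank_perm[OF p] by simp
    qed
    then have "map (\<lambda>x. x + offset ?s ?as i) (std (xss ! i)) = xss ! i"
      by (simp add: std_def map_idI)
    then show "segments ?s ?as ! i = xss ! i" using i by (simp add: segments_nth)
  qed simp
  then show ?thesis by (simp add: inflate_eq_concat)
qed

lemma valid_blocks_map_std:
  assumes "segmentation xss" shows "valid_blocks (block_pattern xss) (map std xss)"
  using assms by (auto simp: valid_blocks_def segmentation_def distinct_concat_iff intro!: is_perm_std)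

lemma perm_contains_std_subseq:
  assumes "subseq xs p" shows "perm_contains p (std xs)"
proof -
  obtain N where N: "xs = nths p N" using assms by (auto simp: subseq_conv_nths)
  have "nths p N = nths p (N \<inter> {0..<length p})"
    unfolding nths_def by (intro arg_cong[of _ _ "map fst"] filter_cong) (auto dest: set_zip_rightD)
  then show ?thesis
    unfolding perm_contains_def N using order_iso_std by (intro exI[of _ "N \<inter> {0..<length p}"]) auto
qed

lemma subseq_map_hd:
  assumes "[] \<notin> set xss" shows "subseq (map hd xss) (concat xss)"
  using assms
proof (induction xss)
  case (Cons A xss)
  then obtain x xs where "A = x # xs" by (cases A) auto
  with Cons show ?case by (simp add: list_emb_append2)
qed simp

lemma subseq_concat: "A \<in> set xss \<Longrightarrow> subseq A (concat xss)"
  by (induction xss) (auto intro: list_emb_append2 subseq_order.order_trans)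

section \<open>Counting\<close>

text \<open>The product rule of counting, by splitting off the length of the first block. Finiteness
  is carried along because the cardinality of the union in the inductive step depends on it.\<close>

lemma prod_list_gen_nth:
  fixes X :: "'o list set" and cl :: "'o list \<Rightarrow> 'i"
  assumes fin: "\<And>n. finite {\<alpha>\<in>X. length \<alpha> = n}"
  defines "f \<equiv> \<lambda>i. Abs_fps (\<lambda>n. of_nat (card {\<alpha>\<in>X. length \<alpha> = n \<and> cl \<alpha> = i})) :: rat fps"
  defines "B \<equiv> \<lambda>w n. {as. set as \<subseteq> X \<and> map cl as = w \<and> sum_list (map length as) = n}"
  shows "finite (B w n) \<and> prod_list (map f w) $ n = of_nat (card (B w n))"
proof (induction w arbitrary: n)
  case Nil
  have "B [] n = (if n = 0 then {[]} else {})" by (auto simp: B_def)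
  then show ?case by simp
next
  case (Cons i w)
  define F where "F = (\<lambda>k. {\<alpha>\<in>X. length \<alpha> = k \<and> cl \<alpha> = i})"
  have finF: "finite (F k)" for k
    by (rule finite_subset[OF _ fin[of k]]) (auto simp: F_def)
  have B: "B (i # w) n = (\<Union>k\<in>{0..n}. (\<lambda>(\<alpha>, as). \<alpha> # as) ` (F k \<times> B w (n - k)))"
  proof (intro equalityI subsetI)
    fix as assume "as \<in> B (i # w) n"
    then obtain \<alpha> as' where as: "as = \<alpha> # as'" "cl \<alpha> = i" "map cl as' = w" "\<alpha> \<in> X" "set as' \<subseteq> X"
      "length \<alpha> + sum_list (map length as') = n"
      by (cases as) (auto simp: B_def)
    then have "(\<alpha>, as') \<in> F (length \<alpha>) \<times> B w (n - length \<alpha>)" "length \<alpha> \<in> {0..n}"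
      by (auto simp: F_def B_def)
    then show "as \<in> (\<Union>k\<in>{0..n}. (\<lambda>(\<alpha>, as). \<alpha> # as) ` (F k \<times> B w (n - k)))"
      using as(1) by (intro UN_I[of "length \<alpha>"]) (auto intro!: image_eqI[of _ _ "(\<alpha>, as')"])
  qed (auto simp: F_def B_def)
  have fin': "finite ((\<lambda>(\<alpha>, as). \<alpha> # as) ` (F k \<times> B w (n - k)))" for k
    using finF Cons.IH by auto
  have "card (B (i # w) n) = (\<Sum>k\<in>{0..n}. card ((\<lambda>(\<alpha>, as). \<alpha> # as) ` (F k \<times> B w (n - k))))"
    unfolding B using fin' by (intro card_UN_disjoint) (auto simp: F_def)
  also have "\<dots> = (\<Sum>k\<in>{0..n}. card (F k) * card (B w (n - k)))"
    by (intro sum.cong refl, subst card_image) (auto simp: inj_on_def card_cartesian_product)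
  finally have "card (B (i # w) n) = (\<Sum>k\<in>{0..n}. card (F k) * card (B w (n - k)))" .
  moreover have "prod_list (map f (i # w)) $ n = (\<Sum>k\<in>{0..n}. of_nat (card (F k)) * of_nat (card (B w (n - k))))"
    using Cons.IH by (simp add: fps_mult_nth f_def F_def)
  moreover have "finite (B (i # w) n)" unfolding B using fin' by auto
  ultimately show ?case by simp
qed

lemma is_perm_Cons_Nil: "is_perm [x] \<longleftrightarrow> x = 0"
  by (auto simp: is_perm_def)

lemma finite_perms: "finite {p. is_perm p \<and> length p = n}"
  by (rule finite_subset[OF _ finite_lists_length_eq[of "{0..<n}" n]]) (auto simp: is_perm_def)

lemma length_inflate:
  assumes "length as = length s"
  shows "length (inflate s as) = sum_list (map length as)"
proof -
  have "map length (segments s as) = map length as"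
    using assms by (intro nth_equalityI) (auto simp: segments_nth)
  then show ?thesis by (simp add: inflate_eq_concat length_concat)
qed

section \<open>The equations of a query-complete class\<close>

locale query_class =
  fixes C :: "nat list set" and \<P> :: "nat list set set"
  assumes perm_class: "perm_class C" and wreath: "wreath_closed C"
    and finite_simples: "finite {\<pi>\<in>C. simple_perm \<pi>}"
    and finite_P: "finite \<P>" and query: "query_complete \<P>"
begin

definition cl :: "nat list \<Rightarrow> nat list set set \<times> bool \<times> bool" where
  "cl p = ({P\<in>\<P>. p \<in> P}, dec (<) p, dec (>) p)"

definition decomps :: "(nat list \<times> nat list list) set" where
  "decomps = {(s, as). s \<in> C \<and> simple_perm s \<and> length s \<ge> 2 \<and> valid_blocks s as \<and> set as \<subseteq> C \<and>
     (s = [0, 1] \<longrightarrow> \<not> dec (<) (as ! 0)) \<and> (s = [1, 0] \<longrightarrow> \<not> dec (>) (as ! 0))}"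

lemma C_perm: "p \<in> C \<Longrightarrow> is_perm p"
  using perm_class unfolding perm_class_def by blast

lemma C_contains: "p \<in> C \<Longrightarrow> is_perm q \<Longrightarrow> perm_contains p q \<Longrightarrow> q \<in> C"
  using perm_class unfolding perm_class_def by blast

lemma inflate_in_C: "(s, as) \<in> decomps \<Longrightarrow> inflate s as \<in> C"
  using wreath[unfolded wreath_closed_def, rule_format, of s as] by (simp add: decomps_def)

lemma decomps_segmentation:
  assumes "(s, as) \<in> decomps"
  shows "segmentation (segments s as)" "block_pattern (segments s as) = s"
proof -
  have "valid_blocks s as" "is_perm s" using assms by (simp_all add: decomps_def C_perm)
  then show "segmentation (segments s as)" "block_pattern (segments s as) = s"
    using segmentation_segments[OF _ _ C_perm[OF inflate_in_C[OF assms]]] by blast+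
qed

lemma decomps_canonical:
  assumes "(s, as) \<in> decomps" shows "canonical (segments s as)"
proof -
  have *: "simple_perm s" "length s \<ge> 2" "valid_blocks s as"
    "s = [0, 1] \<longrightarrow> \<not> dec (<) (as ! 0)" "s = [1, 0] \<longrightarrow> \<not> dec (>) (as ! 0)"
    using assms by (simp_all add: decomps_def)
  have "std (hd (segments s as)) = as ! 0"
  proof -
    have "segments s as \<noteq> []" using *(2) by (auto simp: segments_def)
    then have "std (hd (segments s as)) = map std (segments s as) ! 0"
      by (simp add: hd_conv_nth nth_map del: length_segments)
    then show ?thesis by (simp add: map_std_segments[OF *(3)])
  qed
  then have "dec (<) (hd (segments s as)) \<longleftrightarrow> dec (<) (as ! 0)"
    "dec (>) (hd (segments s as)) \<longleftrightarrow> dec (>) (as ! 0)"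
    using dec_std[of "(<)" "hd (segments s as)"] dec_std[of "(>)" "hd (segments s as)"] by simp_all
  then show ?thesis
    unfolding canonical_def decomps_segmentation(2)[OF assms] length_segments
    using * decomps_segmentation(1)[OF assms] by blast
qed

text \<open>Uniqueness of canonical segmentations gives equal segments; their pattern returns
  \<open>s\<close> and their standardisations return the blocks.\<close>

lemma inj_inflate: "inj_on (\<lambda>(s, as). inflate s as) decomps"
proof (rule inj_onI, clarify)
  fix s as s' as' assume *: "(s, as) \<in> decomps" "(s', as') \<in> decomps" "inflate s as = inflate s' as'"
  then have eq: "segments s as = segments s' as'"
    by (intro canonical_unique decomps_canonical) (simp_all add: inflate_eq_concat)
  then have "s = s'" using decomps_segmentation(2)[OF *(1)] decomps_segmentation(2)[OF *(2)] by simp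
  moreover have "as = as'"
    using map_std_segments[of s as] map_std_segments[of s' as'] eq * by (simp add: decomps_def)
  ultimately show "s = s' \<and> as = as'" by simp
qed

lemma length_inflate_ge_2:
  assumes "(s, as) \<in> decomps" shows "length (inflate s as) \<ge> 2"
proof -
  have v: "length as = length s" "length s \<ge> 2" "\<And>\<alpha>. \<alpha> \<in> set as \<Longrightarrow> \<alpha> \<noteq> []"
    using assms by (auto simp: decomps_def valid_blocks_def)
  have "sum_list (map (\<lambda>_. 1) as) \<le> sum_list (map length as)"
    using v(3) by (intro sum_list_mono) (auto simp: Suc_le_eq)
  then show ?thesis using v(1,2) by (simp add: length_inflate[OF v(1)] sum_list_triv)
qed

lemma decomps_exists:
  assumes "p \<in> C" "length p \<ge> 2"
  obtains s as where "(s, as) \<in> decomps" "inflate s as = p"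
proof -
  have p: "is_perm p" using assms(1) by (rule C_perm)
  then obtain xss where xss: "canonical xss" "concat xss = p"
    using canonical_exists[OF is_perm_dist assms(2)] by blast
  have seg: "segmentation xss" using xss(1) by (simp add: canonical_def)
  then have ne: "[] \<notin> set xss" by (simp add: segmentation_def)
  have v: "valid_blocks (block_pattern xss) (map std xss)"
    using seg by (rule valid_blocks_map_std)
  have "block_pattern xss \<in> C"
  proof (rule C_contains[OF assms(1)])
    show "is_perm (block_pattern xss)" using xss(1) by (simp add: canonical_def simple_perm_def)
    show "perm_contains p (block_pattern xss)"
      using subseq_map_hd[OF ne] xss(2) by (intro perm_contains_std_subseq) simp
  qed
  moreover have "std A \<in> C" if "A \<in> set xss" for A
  proof (rule C_contains[OF assms(1)])
    show "is_perm (std A)" using v that by (auto simp: valid_blocks_def)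
    show "perm_contains p (std A)"
      using subseq_concat[OF that] xss(2) by (intro perm_contains_std_subseq) simp
  qed
  moreover have "xss \<noteq> []" using xss(1) by (auto simp: canonical_def)
  then have "map std xss ! 0 = std (hd xss)" by (simp add: hd_conv_nth)
  ultimately have "(block_pattern xss, map std xss) \<in> decomps"
    using xss(1) v unfolding canonical_def decomps_def by (auto simp: dec_std)
  moreover have "inflate (block_pattern xss) (map std xss) = p"
    using inflate_block_pattern[OF seg] p xss(2) by simp
  ultimately show ?thesis using that by blast
qed

lemma dec_inflate:
  assumes "(s, as) \<in> decomps" "R = (<) \<or> R = (>)"
  shows "dec R (inflate s as) \<longleftrightarrow> dec R s"
proof -
  have "length (segments s as) \<ge> 2" using assms(1) by (simp add: decomps_def)
  then have "dec R (inflate s as) \<longleftrightarrow> dec R (block_pattern (segments s as))"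
    unfolding inflate_eq_concat
    using decomps_segmentation(1)[OF assms(1)] assms(2) by (simp add: dec_concat_iff dec_std)
  then show ?thesis by (simp add: decomps_segmentation(2)[OF assms(1)])
qed

text \<open>The exchange principle behind the equations. The flags in \<open>cl\<close> preserve the
  condition on the first block, query-completeness preserves the properties of the result, and
  \<open>dec_inflate\<close> preserves its flags.\<close>

lemma decomps_cong:
  assumes "(s, as) \<in> decomps" "map cl bs = map cl as" "\<And>\<beta>. \<beta> \<in> set bs \<Longrightarrow> \<beta> \<in> C \<and> \<beta> \<noteq> []"
  shows "(s, bs) \<in> decomps" "cl (inflate s bs) = cl (inflate s as)"
proof -
  have len: "length bs = length as" "length as = length s" "length s \<ge> 2"
    using assms(1) map_eq_imp_length_eq[OF assms(2)] by (auto simp: decomps_def valid_blocks_def)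
  have cl_nth: "cl (bs ! i) = cl (as ! i)" if "i < length s" for i
    using assms(2) len that by (metis nth_map)
  have v: "valid_blocks s bs" using assms(3) len C_perm by (auto simp: valid_blocks_def)
  have "cl (bs ! 0) = cl (as ! 0)" using cl_nth[of 0] len(3) by force
  then have "dec (<) (bs ! 0) \<longleftrightarrow> dec (<) (as ! 0)" "dec (>) (bs ! 0) \<longleftrightarrow> dec (>) (as ! 0)"
    by (simp_all add: cl_def)
  then show bs: "(s, bs) \<in> decomps"
    using assms(1,3) v by (auto simp: decomps_def)
  have "inflate s bs \<in> P \<longleftrightarrow> inflate s as \<in> P" if "P \<in> \<P>" for P
  proof -
    have "is_perm s" "valid_blocks s as" using assms(1) by (auto simp: decomps_def simple_perm_def)
    moreover have "bs ! i \<in> Q \<longleftrightarrow> as ! i \<in> Q" if "i < length s" "Q \<in> \<P>" for i Q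
      using cl_nth[OF that(1)] that(2) unfolding cl_def by blast
    ultimately show ?thesis using query v that unfolding query_complete_def by blast
  qed
  then show "cl (inflate s bs) = cl (inflate s as)"
    using dec_inflate[OF bs] dec_inflate[OF assms(1)] by (auto simp: cl_def)
qed

text \<open>The simple permutation is kept beside the word so that different patterns with equal
  block classes give separate terms. Only the classes of the blocks are retained, which makes this
  set finite.\<close>

definition T :: "nat list set set \<times> bool \<times> bool \<Rightarrow> (nat list \<times> (nat list set set \<times> bool \<times> bool) list) set" where
  "T i = {(s, map cl as) |s as. (s, as) \<in> decomps \<and> cl (inflate s as) = i}"

abbreviation X :: "nat list set" where "X \<equiv> C - {[]}"

abbreviation count :: "nat list set set \<times> bool \<times> bool \<Rightarrow> rat fps" where
  "count i \<equiv> Abs_fps (\<lambda>n. of_nat (card {\<alpha>\<in>X. length \<alpha> = n \<and> cl \<alpha> = i}))"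

abbreviation blocks :: "(nat list set set \<times> bool \<times> bool) list \<Rightarrow> nat \<Rightarrow> nat list list set" where
  "blocks w n \<equiv> {as. set as \<subseteq> X \<and> map cl as = w \<and> sum_list (map length as) = n}"

lemma finite_X: "finite {\<alpha>\<in>X. length \<alpha> = n}"
  by (rule finite_subset[OF _ finite_perms[of n]]) (auto dest: C_perm)

lemma cl_range: "set (map cl as) \<subseteq> Pow \<P> \<times> UNIV"
  by (auto simp: cl_def)

lemma finite_T: "finite (T i)"
proof (rule finite_subset)
  let ?S = "{s\<in>C. simple_perm s}"
  show "T i \<subseteq> (SIGMA s:?S. {w. set w \<subseteq> Pow \<P> \<times> UNIV \<and> length w = length s})"
  proof
    fix t assume "t \<in> T i"
    then obtain s as where t: "t = (s, map cl as)" "(s, as) \<in> decomps" unfolding T_def by blast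
    then have "s \<in> ?S" "length (map cl as) = length s" by (auto simp: decomps_def valid_blocks_def)
    with t(1) cl_range[of as]
    show "t \<in> (SIGMA s:?S. {w. set w \<subseteq> Pow \<P> \<times> UNIV \<and> length w = length s})" by blast
  qed
  show "finite (SIGMA s:?S. {w. set w \<subseteq> Pow \<P> \<times> (UNIV :: (bool \<times> bool) set) \<and> length w = length s})"
    using finite_simples finite_P by (intro finite_SigmaI finite_lists_length_eq) auto
qed

text \<open>One inclusion is the existence of canonical decompositions. For the other, a term of
  \<open>T i\<close> is realised by some sequence of blocks, and \<open>decomps_cong\<close>
  transfers this to every sequence with the same classes.\<close>

lemma long_eq_image:
  "{\<alpha>\<in>X. length \<alpha> = n \<and> cl \<alpha> = i \<and> length \<alpha> \<ge> 2} =
   (\<lambda>(t, as). inflate (fst t) as) ` (SIGMA t:T i. blocks (snd t) n)" (is "?l = ?r")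
proof (intro equalityI subsetI)
  fix p assume p: "p \<in> ?l"
  then obtain s as where sa: "(s, as) \<in> decomps" "inflate s as = p"
    using decomps_exists by blast
  have "length as = length s" "set as \<subseteq> X"
    using sa(1) by (auto simp: decomps_def valid_blocks_def)
  then have "as \<in> blocks (map cl as) n" using p sa(2) length_inflate[of as s] by auto
  moreover have "(s, map cl as) \<in> T i" using sa p by (auto simp: T_def)
  ultimately show "p \<in> ?r" using sa(2) by (intro image_eqI[of _ _ "((s, map cl as), as)"]) auto
next
  fix p assume "p \<in> ?r"
  then obtain s w as where *: "(s, w) \<in> T i" "as \<in> blocks w n" "p = inflate s as" by auto
  from *(1) obtain as' where as': "w = map cl as'" "(s, as') \<in> decomps" "cl (inflate s as') = i"
    by (auto simp: T_def)
  have "(s, as) \<in> decomps" "cl (inflate s as) = i"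
    using decomps_cong[OF as'(2), of as] *(2) as'(1,3) by auto
  moreover from this have "length as = length s" by (auto simp: decomps_def valid_blocks_def)
  then have "length p = n" using *(2,3) by (simp add: length_inflate)
  ultimately show "p \<in> ?l"
    using inflate_in_C[of s as] length_inflate_ge_2[of s as] *(3) by auto
qed

lemma inj_long: "inj_on (\<lambda>(t, as). inflate (fst t) as) (SIGMA t:T i. blocks (snd t) n)"
proof (rule inj_onI, clarify)
  fix s w as s' w' as'
  assume *: "(s, w) \<in> T i" "set as \<subseteq> X" "map cl as = snd (s, w)"
    "(s', w') \<in> T i" "set as' \<subseteq> X" "map cl as' = snd (s', w')"
    "inflate (fst (s, w)) as = inflate (fst (s', w')) as'"
  have "(s, as) \<in> decomps" if "(s, w) \<in> T i" "set as \<subseteq> X" "map cl as = w" for s w as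
  proof -
    from that(1) obtain bs where "w = map cl bs" "(s, bs) \<in> decomps" by (auto simp: T_def)
    then show ?thesis using decomps_cong(1)[of s bs as] that(2,3) by auto
  qed
  then have "(s, as) \<in> decomps" "(s', as') \<in> decomps" using * by auto
  with inj_onD[OF inj_inflate, of "(s, as)" "(s', as')"] *(7) have "s = s'" "as = as'" by auto
  with *(3,6) show "(s, w) = (s', w') \<and> as = as'" by auto
qed

lemma count_eq:
  "count i = of_bool ([0] \<in> C \<and> cl [0] = i) * fps_X + (\<Sum>t\<in>T i. prod_list (map count (snd t)))"
proof (rule fps_ext)
  fix n
  let ?long = "{\<alpha>\<in>X. length \<alpha> = n \<and> cl \<alpha> = i \<and> length \<alpha> \<ge> 2}"
  let ?short = "{\<alpha>\<in>X. length \<alpha> = n \<and> cl \<alpha> = i \<and> length \<alpha> < 2}"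
  have fin: "finite ?long" "finite ?short" by (rule finite_subset[OF _ finite_X[of n]]; auto)+
  have "?short \<inter> ?long = {}" by auto
  then have "card (?short \<union> ?long) = card ?short + card ?long"
    by (rule card_Un_disjoint[OF fin(2,1)])
  moreover have "?short \<union> ?long = {\<alpha>\<in>X. length \<alpha> = n \<and> cl \<alpha> = i}" by auto
  ultimately have card: "card {\<alpha>\<in>X. length \<alpha> = n \<and> cl \<alpha> = i} = card ?short + card ?long"
    by (simp only:)
  \<comment> \<open>The one-point permutation is the only nonempty one too short to be decomposed;
    it yields the linear term.\<close>
  have short: "?short = (if n = 1 \<and> [0] \<in> C \<and> cl [0] = i then {[0]} else {})"
  proof -
    have "\<alpha> = [0]" if "\<alpha> \<in> X" "length \<alpha> < 2" for \<alpha>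
      using that C_perm[of \<alpha>] by (cases \<alpha>; cases "tl \<alpha>") (auto simp: is_perm_Cons_Nil)
    then have iff: "\<alpha> \<in> X \<and> length \<alpha> < 2 \<longleftrightarrow> \<alpha> = [0] \<and> [0] \<in> C" for \<alpha> by auto
    have "?short = {\<alpha>. (\<alpha> \<in> X \<and> length \<alpha> < 2) \<and> length \<alpha> = n \<and> cl \<alpha> = i}" by blast
    also have "\<dots> = (if n = 1 \<and> [0] \<in> C \<and> cl [0] = i then {[0]} else {})"
      unfolding iff by auto
    finally show ?thesis .
  qed
  have "card ?short = of_bool (n = 1 \<and> [0] \<in> C \<and> cl [0] = i)"
    unfolding short by simp
  moreover have "card ?long = (\<Sum>t\<in>T i. card (blocks (snd t) n))"
    unfolding long_eq_image card_image[OF inj_long]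
    using finite_T prod_list_gen_nth[OF finite_X, where cl = cl] by (intro card_SigmaI) auto
  ultimately have "count i $ n = of_nat (of_bool (n = 1 \<and> [0] \<in> C \<and> cl [0] = i) +
      (\<Sum>t\<in>T i. card (blocks (snd t) n)))"
    by (simp only: fps_nth_Abs_fps card)
  then show "count i $ n =
      (of_bool ([0] \<in> C \<and> cl [0] = i) * fps_X + (\<Sum>t\<in>T i. prod_list (map count (snd t)))) $ n"
    using prod_list_gen_nth[OF finite_X, where cl = cl] by (simp add: fps_sum_nth)
qed

text \<open>Since \<open>\<Q> \<subseteq> \<P>\<close>, the first component of the class decides
  whether all of \<open>\<Q>\<close> hold, so the permutations counted are a union of classes plus
  possibly the empty permutation.\<close>

lemma gen_fun_eq:
  assumes "\<Q> \<subseteq> \<P>"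
  shows "gen_fun C \<Q> = of_bool ([] \<in> C \<and> (\<forall>Q\<in>\<Q>. [] \<in> Q)) +
    (\<Sum>i\<in>{i\<in>Pow \<P> \<times> UNIV. \<Q> \<subseteq> fst i}. count i)"
proof (rule fps_ext)
  fix n
  let ?J = "{i\<in>Pow \<P> \<times> (UNIV :: (bool \<times> bool) set). \<Q> \<subseteq> fst i}"
  let ?N = "{\<pi>\<in>{[]} \<inter> C. length \<pi> = n \<and> (\<forall>Q\<in>\<Q>. \<pi> \<in> Q)}"
  have "finite ?J" using finite_P by (intro finite_subset[of ?J "Pow \<P> \<times> UNIV"]) auto
  have fin: "finite {\<alpha>\<in>X. length \<alpha> = n \<and> cl \<alpha> = i}" for i
    by (rule finite_subset[OF _ finite_X[of n]]) auto
  have "{\<pi>\<in>C. length \<pi> = n \<and> (\<forall>Q\<in>\<Q>. \<pi> \<in> Q)} = ?N \<union> (\<Union>i\<in>?J. {\<alpha>\<in>X. length \<alpha> = n \<and> cl \<alpha> = i})"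
    using assms by (auto simp: cl_def)
  also have "card \<dots> = card ?N + card (\<Union>i\<in>?J. {\<alpha>\<in>X. length \<alpha> = n \<and> cl \<alpha> = i})"
    using fin \<open>finite ?J\<close> by (intro card_Un_disjoint) auto
  also have "card (\<Union>i\<in>?J. {\<alpha>\<in>X. length \<alpha> = n \<and> cl \<alpha> = i}) =
      (\<Sum>i\<in>?J. card {\<alpha>\<in>X. length \<alpha> = n \<and> cl \<alpha> = i})"
    using fin \<open>finite ?J\<close> by (intro card_UN_disjoint) auto
  also have "?N = (if n = 0 \<and> [] \<in> C \<and> (\<forall>Q\<in>\<Q>. [] \<in> Q) then {[]} else {})" by auto
  finally show "gen_fun C \<Q> $ n = (of_bool ([] \<in> C \<and> (\<forall>Q\<in>\<Q>. [] \<in> Q)) + (\<Sum>i\<in>?J. count i)) $ n"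
    by (auto simp: gen_fun_def fps_sum_nth)
qed

theorem gen_fun_algebraic:
  assumes "\<Q> \<subseteq> \<P>" shows "fps_algebraic (gen_fun C \<Q>)"
proof -
  interpret word_system "Pow \<P> \<times> UNIV" T snd "\<lambda>i. [0] \<in> C \<and> cl [0] = i"
  proof
    show "finite (Pow \<P> \<times> (UNIV :: (bool \<times> bool) set))" using finite_P by simp
    show "finite (T i)" for i by (rule finite_T)
    show "set (snd t) \<subseteq> Pow \<P> \<times> UNIV" if t: "t \<in> T i" for i t
    proof -
      obtain as where "snd t = map cl as" using t by (auto simp: T_def)
      then show ?thesis using cl_range by simp
    qed
    show "length (snd t) \<ge> 2" if "t \<in> T i" for i t
      using that by (auto simp: T_def decomps_def valid_blocks_def)
  qed
  show ?thesis
    unfolding gen_fun_eq[OF assms]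
    \<comment> \<open>The constant terms vanish because \<open>X\<close> omits the empty
      permutation.\<close>
    by (rule solution_algebraic[OF _ count_eq]) auto
qed

end

theorem theorem3p1:
  fixes C :: "nat list set" and \<P> \<Q> :: "nat list set set"
  assumes "perm_class C" and "wreath_closed C"
    and "finite {\<pi>\<in>C. simple_perm \<pi>}"
    and "finite \<P>" and "query_complete \<P>" and "\<Q> \<subseteq> \<P>"
  shows "fps_algebraic (gen_fun C \<Q>)"
proof -
  interpret query_class C \<P> by unfold_locales (rule assms)+
  show ?thesis using assms(6) by (rule gen_fun_algebraic)
qed

end
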